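(* For each integer $k\ge 3$, we have $\mu_k^{\mathrm S}=2$ if and only if $f_k(N)=(\log N)^{1-o(1)}$ as $N\to\infty$.
   Context: For integers $k\ge 3$ and $N\ge1$, a set $A\subseteq\{1,\dots,N\}$ is LCM-$k$-free if it does not contain distinct $a_1,\dots,a_k$ such that $\operatorname{lcm}(a_i,a_j)$ is the same for all $1\le i<j\le k$; $f_k(N):=\max\{\sum_{a\in A}1/a : A\subseteq\{1,\dots,N\}\text{ LCM-}k\text{-free}\}$. A collection of $k$ distinct sets $S_1,\dots,S_k$ is a $k$-sunflower if $S_i\cap S_j=S_1\cap S_2$ for all $1\le i<j\le k$; a family is $k$-sunflower-free if no $k$ distinct members form a $k$-sunflower. $F_k(n)$ denotes the maximum size of a $k$-sunflower-free family $\mathcal F\subseteq 2^{[n]}$, and $\mu_k^{\mathrm S}:=\limsup_{n\to\infty}F_k(n)^{1/n}$ (the Erdős–Szemerédi $k$-sunflower-free capacity). The statement $f_k(N)=(\log N)^{1-o(1)}$ means $f_k(N)=(\log N)^{1-\varepsilon(N)}$ with $\varepsilon(N)\to0$. *)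

theory Defs
  imports "HOL-Analysis.Analysis"
begin

definition lcm_free :: "nat \<Rightarrow> nat set \<Rightarrow> bool" where
  "lcm_free k A \<longleftrightarrow>
     \<not> (\<exists>a :: nat \<Rightarrow> nat. inj_on a {1..k} \<and> a ` {1..k} \<subseteq> A \<and>
          (\<exists>L. \<forall>i j. 1 \<le> i \<and> i < j \<and> j \<le> k \<longrightarrow> lcm (a i) (a j) = L))"

definition lcm_free_max :: "nat \<Rightarrow> nat \<Rightarrow> real" where
  "lcm_free_max k N = Max {(\<Sum>a\<in>A. 1 / real a) | A. A \<subseteq> {1..N} \<and> lcm_free k A}"

definition is_sunflower :: "nat \<Rightarrow> (nat \<Rightarrow> 'a set) \<Rightarrow> bool" where
  "is_sunflower k S \<longleftrightarrow> inj_on S {1..k} \<and>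
     (\<forall>i j. 1 \<le> i \<and> i < j \<and> j \<le> k \<longrightarrow> S i \<inter> S j = S 1 \<inter> S 2)"

definition sunflower_free :: "nat \<Rightarrow> 'a set set \<Rightarrow> bool" where
  "sunflower_free k \<F> \<longleftrightarrow> \<not> (\<exists>S. S ` {1..k} \<subseteq> \<F> \<and> is_sunflower k S)"

definition sunflower_free_max :: "nat \<Rightarrow> nat \<Rightarrow> nat" where
  "sunflower_free_max k n = Max {card \<F> | \<F>. \<F> \<subseteq> Pow {1..n} \<and> sunflower_free k \<F>}"

definition sunflower_capacity :: "nat \<Rightarrow> ereal" where
  "sunflower_capacity k = limsup (\<lambda>n. ereal (real (sunflower_free_max k n) powr (1 / real n)))"

text \<open>Both maxima range over finite sets that are nonempty for \<open>k \<ge> 1\<close>, so \<open>Max\<close> is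
  well-defined.\<close>

lemma finite_lcm_free_sums:
  "finite {(\<Sum>a\<in>A. 1 / real a) | A. A \<subseteq> {1..N} \<and> lcm_free k A}"
  by (rule finite_subset[of _ "(\<lambda>A. \<Sum>a\<in>A. 1 / real a) ` Pow {1..N}"]) auto

lemma lcm_free_empty: "k \<ge> 1 \<Longrightarrow> lcm_free k {}"
  by (auto simp: lcm_free_def)

lemma finite_sunflower_free_cards:
  "finite {card \<F> | \<F>. \<F> \<subseteq> Pow {1..n::nat} \<and> sunflower_free k \<F>}"
  by (rule finite_subset[of _ "card ` Pow (Pow {1..n})"]) auto

lemma sunflower_free_empty: "k \<ge> 1 \<Longrightarrow> sunflower_free k {}"
  by (auto simp: sunflower_free_def)

end

theory Submission
  imports Defs "HOL-Computational_Algebra.Squarefree" "HOL-Real_Asymp.Real_Asymp"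
begin

text \<open>
  Taking complements turns sunflowers into sets with equal pairwise unions, and for squarefree
  integers, viewed as sets of primes, equal unions mean equal LCMs. Both directions then change the
  bias of a product measure by averaging.

  Let \<open>A \<subseteq> {1..N}\<close> be LCM-free. Writing \<open>a = s\<^sup>2 r\<close> with \<open>r\<close> squarefree, a single \<open>s\<close> carries a
  positive proportion of the reciprocal sum. A random set \<open>Q\<close> of primes up to \<open>N\<close>, containing \<open>p\<close>
  with probability \<open>p^(-1-1/log N)\<close>, contains on average at least a constant multiple of \<open>\<Sum>1/a\<close> of
  the resulting prime sets, while \<open>2^|Q|\<close> has mean at most \<open>1 + log N\<close>. Hence some large \<open>Q\<close> carries
  a union-free family of at least a constant times \<open>2^|Q| (\<Sum>1/a) / log N\<close> sets, so \<open>\<Sum>1/a\<close> is small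
  if the capacity is below 2.

  Conversely, let \<open>\<F>\<close> be a union-free family of \<open>2^((1 - o(1))n)\<close> subsets of an \<open>n\<close>-set. Fixing a
  random set \<open>T\<close> of elements to be present, some link of \<open>\<F>\<close> is nearly full for the measure with
  weights \<open>\<delta>^|S|\<close>; one of its layers is a uniform union-free family, and uniform families can be
  raised to powers. Replacing each ground element by a group of primes whose reciprocals sum to
  about \<open>\<delta>\<close> and choosing one prime from each group in \<open>S\<close> gives an LCM-free set. It captures a
  proportion \<open>log(1 + \<delta>)/\<delta> \<rightarrow> 1\<close> of the exponent, and \<open>\<Sum>1/p \<ge> log log N - O(1)\<close> is the only
  arithmetic input.
\<close>

section \<open>Homogeneous sets\<close>

text \<open>A binary operation \<open>f\<close> is viewed as a colouring of pairs: sunflowers are homogeneous for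
  \<open>(\<inter>)\<close>, and tuples with equal pairwise LCMs are homogeneous for \<open>lcm\<close>.\<close>

definition homogeneous_free :: "('a \<Rightarrow> 'a \<Rightarrow> 'b) \<Rightarrow> nat \<Rightarrow> 'a set \<Rightarrow> bool" where
  "homogeneous_free f k A \<longleftrightarrow>
     \<not> (\<exists>B c. B \<subseteq> A \<and> card B = k \<and> pairwise (\<lambda>x y. f x y = c) B)"

abbreviation union_free :: "nat \<Rightarrow> 'a set set \<Rightarrow> bool" where
  "union_free \<equiv> homogeneous_free (\<union>)"

lemma homogeneous_free_subset: "homogeneous_free f k A \<Longrightarrow> B \<subseteq> A \<Longrightarrow> homogeneous_free f k B"
  unfolding homogeneous_free_def by blast

lemma homogeneous_free_if_card_less:
  assumes "finite A" "card A < k"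
  shows "homogeneous_free f k A"
  unfolding homogeneous_free_def
proof (intro notI, elim exE conjE)
  fix B assume "B \<subseteq> A" "card B = k"
  then show False using card_mono[OF assms(1), of B] assms(2) by simp
qed

lemma homogeneous_free_imp_not_inj_on:
  assumes "homogeneous_free f k A" "card I = k" "a ` I \<subseteq> A"
    and const: "pairwise (\<lambda>i j. f (a i) (a j) = c) I"
  shows "\<not> inj_on a I"
proof
  assume "inj_on a I"
  then have "card (a ` I) = k" using assms(2) by (simp add: card_image)
  moreover have "pairwise (\<lambda>x y. f x y = c) (a ` I)"
    using const by (auto simp: pairwise_def)
  ultimately show False using assms(1,3) unfolding homogeneous_free_def by blast
qed

lemma homogeneous_free_if_image:
  assumes "homogeneous_free f k (g ` A)" "inj_on g A"
    and hom: "\<And>x y. x \<in> A \<Longrightarrow> y \<in> A \<Longrightarrow> f (g x) (g y) = h (f' x y)"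
  shows "homogeneous_free f' k A"
  unfolding homogeneous_free_def
proof (intro notI, elim exE conjE)
  fix B c assume B: "B \<subseteq> A" "card B = k" "pairwise (\<lambda>x y. f' x y = c) B"
  then have "pairwise (\<lambda>x y. f (g x) (g y) = h c) B"
    using hom unfolding pairwise_def by blast
  then have "\<not> inj_on g B"
    using homogeneous_free_imp_not_inj_on[OF assms(1) B(2)] B(1) by blast
  then show False using inj_on_subset[OF assms(2) B(1)] by blast
qed

lemma homogeneous_free_iff_no_tuple:
  assumes commute: "\<And>x y. f x y = f y x"
  shows "homogeneous_free f k A \<longleftrightarrow> \<not> (\<exists>a :: nat \<Rightarrow> 'a. inj_on a {1..k} \<and> a ` {1..k} \<subseteq> A \<and>
    (\<exists>c. \<forall>i j. 1 \<le> i \<and> i < j \<and> j \<le> k \<longrightarrow> f (a i) (a j) = c))"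
    (is "_ \<longleftrightarrow> \<not> ?tuple")
proof
  assume free: "homogeneous_free f k A"
  show "\<not> ?tuple"
  proof (intro notI, elim exE conjE)
    fix a :: "nat \<Rightarrow> 'a" and c
    assume a: "inj_on a {1..k}" "a ` {1..k} \<subseteq> A"
      and const: "\<forall>i j. 1 \<le> i \<and> i < j \<and> j \<le> k \<longrightarrow> f (a i) (a j) = c"
    have "pairwise (\<lambda>i j. f (a i) (a j) = c) {1..k}"
    proof (rule pairwiseI)
      fix i j assume "i \<in> {1..k}" "j \<in> {1..k}" "i \<noteq> j"
      then show "f (a i) (a j) = c"
        using const commute[of "a i" "a j"] by (cases "i < j") auto
    qed
    then show False using homogeneous_free_imp_not_inj_on[OF free _ a(2)] a(1) by simp
  qed
next
  assume no_tuple: "\<not> ?tuple"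
  show "homogeneous_free f k A"
    unfolding homogeneous_free_def
  proof (intro notI, elim exE conjE)
    fix B c assume B: "B \<subseteq> A" "card B = k" "pairwise (\<lambda>x y. f x y = c) B"
    obtain a :: "nat \<Rightarrow> 'a" where a: "inj_on a {1..k}" "a ` {1..k} \<subseteq> B"
    proof (cases "finite B")
      case True
      then show thesis
        using ex_bij_betw_nat_finite_1[of B] B(2) that by (auto simp: bij_betw_def)
    next
      case False
      then show thesis using B(2) by (intro that) auto
    qed
    have "f (a i) (a j) = c" if "1 \<le> i" "i < j" "j \<le> k" for i j
    proof (rule pairwiseD(1)[OF B(3)])
      show "a i \<in> B" "a j \<in> B" using that a(2) by auto
      show "a i \<noteq> a j" using that inj_onD[OF a(1), of i j] by auto
    qed
    then have ?tuple using a B(1) by (intro exI[of _ a] exI[of _ c] conjI) auto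
    then show False using no_tuple by (rule notE[rotated])
  qed
qed

lemma lcm_free_iff_homogeneous_free: "lcm_free k A \<longleftrightarrow> homogeneous_free lcm k A"
  unfolding lcm_free_def by (rule homogeneous_free_iff_no_tuple[symmetric]) (rule lcm.commute)

lemma sunflower_free_iff_homogeneous_free:
  assumes "k \<ge> 2"
  shows "sunflower_free k \<F> \<longleftrightarrow> homogeneous_free (\<inter>) k \<F>"
proof -
  have const_iff: "(\<forall>i j. 1 \<le> i \<and> i < j \<and> j \<le> k \<longrightarrow> S i \<inter> S j = S 1 \<inter> S 2) \<longleftrightarrow>
      (\<exists>c. \<forall>i j. 1 \<le> i \<and> i < j \<and> j \<le> k \<longrightarrow> S i \<inter> S j = c)" (is "?L \<longleftrightarrow> ?R")
    for S :: "nat \<Rightarrow> 'a set"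
  proof
    assume ?R
    then obtain c where "\<forall>i j. 1 \<le> i \<and> i < j \<and> j \<le> k \<longrightarrow> S i \<inter> S j = c" by (rule exE)
    moreover from this[rule_format, of 1 2] have "S 1 \<inter> S 2 = c" using assms by linarith
    ultimately show ?L by simp
  qed blast
  show ?thesis
    unfolding sunflower_free_def is_sunflower_def const_iff
      homogeneous_free_iff_no_tuple[OF Int_commute]
    by (simp only: conj_left_commute)
qed

section \<open>Union-free families and the sunflower-free capacity\<close>

lemma bij_betw_complement_Pow: "bij_betw ((-) V) (Pow V) (Pow V)"
  by (rule bij_betwI[where g = "(-) V"]) auto

lemma card_le_sunflower_free_max:
  assumes "finite V" "\<F> \<subseteq> Pow V" "union_free k \<F>" "k \<ge> 2"
  shows "card \<F> \<le> sunflower_free_max k (card V)"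
proof -
  obtain h where h: "bij_betw h {1..card V} V"
    using ex_bij_betw_nat_finite_1[OF assms(1)] by blast
  define g where "g X = V - h ` X" for X
  have g: "bij_betw g (Pow {1..card V}) (Pow V)"
    using bij_betw_trans[OF bij_betw_Pow[OF h] bij_betw_complement_Pow]
    by (simp add: g_def[abs_def] comp_def)
  define \<G> where "\<G> = Pow {1..card V} \<inter> g -` \<F>"
  have inj: "inj_on g \<G>" using g by (auto simp: \<G>_def bij_betw_def intro: inj_on_subset)
  have "g ` \<G> = g ` Pow {1..card V} \<inter> \<F>" by (auto simp: \<G>_def)
  then have image: "g ` \<G> = \<F>" using bij_betw_imp_surj_on[OF g] assms(2) by auto
  have "homogeneous_free (\<inter>) k \<G>"
  proof (rule homogeneous_free_if_image)
    show "union_free k (g ` \<G>)" unfolding image by (rule assms(3))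
    show "g X \<union> g Y = V - h ` (X \<inter> Y)" if "X \<in> \<G>" "Y \<in> \<G>" for X Y
      using that inj_on_image_Int[OF bij_betw_imp_inj_on[OF h], of X Y] by (auto simp: \<G>_def g_def)
  qed (rule inj)
  then have "sunflower_free k \<G>"
    by (simp only: sunflower_free_iff_homogeneous_free[OF assms(4)])
  moreover have "\<G> \<subseteq> Pow {1..card V}" by (simp add: \<G>_def)
  ultimately have "card \<G> \<le> sunflower_free_max k (card V)"
    unfolding sunflower_free_max_def by (intro Max_ge[OF finite_sunflower_free_cards]) blast
  then show ?thesis using card_image[OF inj] image by simp
qed

lemma obtain_sunflower_free_max:
  assumes "k \<ge> 1"
  obtains \<F> where "\<F> \<subseteq> Pow {1..n}" "sunflower_free k \<F>" "card \<F> = sunflower_free_max k n"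
proof -
  let ?M = "{card \<F> |\<F>. \<F> \<subseteq> Pow {1..n} \<and> sunflower_free k \<F>}"
  have "card ({} :: nat set set) \<in> ?M" using sunflower_free_empty[OF assms] by blast
  then have "Max ?M \<in> ?M" by (intro Max_in[OF finite_sunflower_free_cards]) blast
  then obtain \<F> where "\<F> \<subseteq> Pow {1..n}" "sunflower_free k \<F>" "card \<F> = Max ?M"
    unfolding mem_Collect_eq by metis
  then show thesis using that unfolding sunflower_free_max_def by blast
qed

lemma obtain_union_free:
  assumes "k \<ge> 2"
  obtains \<F> where "\<F> \<subseteq> Pow {1..n}" "union_free k \<F>" "card \<F> = sunflower_free_max k n"
proof -
  obtain \<F> where F: "\<F> \<subseteq> Pow {1..n}" "sunflower_free k \<F>" "card \<F> = sunflower_free_max k n"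
    using obtain_sunflower_free_max[of k n] assms by auto
  let ?\<G> = "(-) {1..n} ` \<F>"
  have inj: "inj_on ((-) {1..n}) (Pow {1..n})"
    using bij_betw_complement_Pow by (rule bij_betw_imp_inj_on)
  have "union_free k ?\<G>"
  proof (rule homogeneous_free_if_image[where h = "(-) {1..n}"])
    have "(-) {1..n} ` ?\<G> = (\<lambda>X. X) ` \<F>"
      unfolding image_image using F(1) by (intro image_cong) auto
    then have "(-) {1..n} ` ?\<G> = \<F>" by simp
    then show "homogeneous_free (\<inter>) k ((-) {1..n} ` ?\<G>)"
      using F(2) by (simp only: sunflower_free_iff_homogeneous_free[OF assms])
    show "inj_on ((-) {1..n}) ?\<G>" using inj by (rule inj_on_subset) auto
  qed auto
  moreover have "card ?\<G> = card \<F>" using inj_on_subset[OF inj F(1)] by (rule card_image)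
  ultimately show thesis using F(3) by (intro that[of ?\<G>]) auto
qed

lemma sunflower_free_max_le:
  assumes "k \<ge> 1"
  shows "sunflower_free_max k n \<le> 2 ^ n"
proof -
  obtain \<F> where "\<F> \<subseteq> Pow {1..n}" "card \<F> = sunflower_free_max k n"
    using obtain_sunflower_free_max[OF assms] by metis
  then show ?thesis using card_mono[of "Pow {1..n}" \<F>] by (simp add: card_Pow)
qed

lemma powr_inverse_less_iff:
  fixes x c :: real
  assumes "n > 0" "0 \<le> x" "0 \<le> c"
  shows "x powr (1 / real n) < c \<longleftrightarrow> x < c ^ n"
proof -
  have "x powr (1 / real n) < c \<longleftrightarrow> root n x < root n (c ^ n)"
    using assms by (simp only: root_powr_inverse real_root_power_cancel)
  also have "\<dots> \<longleftrightarrow> x < c ^ n" using assms(1) by simp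
  finally show ?thesis .
qed

lemma eventually_sunflower_free_max_less:
  assumes "sunflower_capacity k < ereal c" "0 \<le> c"
  shows "\<forall>\<^sub>F n in sequentially. real (sunflower_free_max k n) < c ^ n"
  using Limsup_lessD[OF assms(1)[unfolded sunflower_capacity_def]] eventually_gt_at_top[of 0]
proof eventually_elim
  case (elim n)
  then show ?case using assms(2) by (simp add: powr_inverse_less_iff)
qed

lemma frequently_sunflower_free_max_ge:
  assumes "ereal c < sunflower_capacity k" "0 \<le> c"
  shows "\<exists>\<^sub>F n in sequentially. c ^ n \<le> real (sunflower_free_max k n)"
proof (rule ccontr)
  assume "\<not> ?thesis"
  then have "\<forall>\<^sub>F n in sequentially. real (sunflower_free_max k n) < c ^ n"
    by (simp add: not_frequently not_le)
  then have "\<forall>\<^sub>F n in sequentially.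
      ereal (real (sunflower_free_max k n) powr (1 / real n)) \<le> ereal c"
    using eventually_gt_at_top[of 0]
  proof eventually_elim
    case (elim n)
    then have "real (sunflower_free_max k n) powr (1 / real n) < c"
      using assms(2) by (simp add: powr_inverse_less_iff)
    then show ?case by simp
  qed
  then have "sunflower_capacity k \<le> ereal c"
    unfolding sunflower_capacity_def by (rule Limsup_bounded)
  then show False using assms(1) by simp
qed

lemma sunflower_capacity_le_2:
  assumes "k \<ge> 1"
  shows "sunflower_capacity k \<le> 2"
proof (rule ccontr)
  assume "\<not> ?thesis"
  then have "ereal 2 < sunflower_capacity k" by simp
  from ereal_dense2[OF this] obtain c
    where c: "ereal 2 < ereal c" "ereal c < sunflower_capacity k" by blast
  have "\<exists>\<^sub>F n in sequentially. c ^ n \<le> real (sunflower_free_max k n)"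
    using c by (intro frequently_sunflower_free_max_ge) auto
  then have "\<exists>\<^sub>F n in sequentially. c ^ n \<le> real (sunflower_free_max k n) \<and> 0 < n"
    by (rule frequently_eventually_frequently[OF _ eventually_gt_at_top])
  from frequently_ex[OF this] obtain n
    where n: "c ^ n \<le> real (sunflower_free_max k n)" "n > 0" by blast
  have "real (sunflower_free_max k n) \<le> 2 ^ n"
    using sunflower_free_max_le[OF assms, of n] by (metis of_nat_le_iff of_nat_numeral of_nat_power)
  also have "\<dots> < c ^ n" using c(1) n(2) by (intro power_strict_mono) auto
  finally show False using n(1) by simp
qed

section \<open>Random subsets and links\<close>

text \<open>The probability that a random subset of \<open>P\<close>, containing each \<open>p\<close> independently with
  probability \<open>x p\<close>, equals \<open>Q\<close>.\<close>

definition random_subset_prob :: "('a \<Rightarrow> real) \<Rightarrow> 'a set \<Rightarrow> 'a set \<Rightarrow> real" where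
  "random_subset_prob x P Q = prod x Q * (\<Prod>p\<in>P - Q. 1 - x p)"

lemma random_subset_prob_nonneg:
  assumes "\<And>p. p \<in> P \<Longrightarrow> 0 \<le> x p \<and> x p \<le> 1" "Q \<subseteq> P"
  shows "0 \<le> random_subset_prob x P Q"
  unfolding random_subset_prob_def using assms by (intro mult_nonneg_nonneg prod_nonneg) auto

lemma sum_random_subset_prob_prod:
  assumes "finite P"
  shows "(\<Sum>Q\<in>Pow P. random_subset_prob x P Q * prod f Q) = (\<Prod>p\<in>P. 1 + x p * (f p - 1))"
proof -
  have "(\<Sum>Q\<in>Pow P. random_subset_prob x P Q * prod f Q) =
      (\<Sum>Q\<in>Pow P. (\<Prod>p\<in>Q. x p * f p) * (\<Prod>p\<in>P - Q. 1 - x p))"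
    by (simp add: random_subset_prob_def prod.distrib mult_ac)
  also have "\<dots> = (\<Prod>p\<in>P. x p * f p + (1 - x p))" by (rule prod_add[OF assms, symmetric])
  finally show ?thesis by (simp add: algebra_simps)
qed

lemma sum_random_subset_prob_supersets:
  assumes "finite P" "X \<subseteq> P"
  shows "(\<Sum>Q\<in>Pow P. if X \<subseteq> Q then random_subset_prob x P Q else 0) = prod x X"
proof -
  let ?avoid = "\<lambda>p. if p \<in> X then 0 else 1 - x p"
  have "(if X \<subseteq> Q then random_subset_prob x P Q else 0) = prod x Q * prod ?avoid (P - Q)"
    if "Q \<in> Pow P" for Q
  proof (cases "X \<subseteq> Q")
    case True
    then have "prod ?avoid (P - Q) = (\<Prod>p\<in>P - Q. 1 - x p)" by (intro prod.cong) auto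
    then show ?thesis using True by (simp add: random_subset_prob_def)
  next
    case False
    then have "prod ?avoid (P - Q) = 0" using assms by (intro prod_zero) auto
    then show ?thesis using False by simp
  qed
  then have "(\<Sum>Q\<in>Pow P. if X \<subseteq> Q then random_subset_prob x P Q else 0) =
      (\<Sum>Q\<in>Pow P. prod x Q * prod ?avoid (P - Q))"
    by (rule sum.cong[OF refl])
  also have "\<dots> = (\<Prod>p\<in>P. x p + ?avoid p)" by (rule prod_add[OF assms(1), symmetric])
  also have "\<dots> = (\<Prod>p\<in>P. if p \<in> X then x p else 1)" by (intro prod.cong) auto
  also have "\<dots> = prod x X" using assms by (simp add: prod.If_cases Int_absorb1)
  finally show ?thesis .
qed

lemma sum_random_subset_prob_card_members:
  assumes "finite P" "\<B> \<subseteq> Pow P"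
  shows "(\<Sum>Q\<in>Pow P. random_subset_prob x P Q * real (card {X\<in>\<B>. X \<subseteq> Q})) = (\<Sum>X\<in>\<B>. prod x X)"
proof -
  have "finite \<B>" using assms by (meson finite_Pow_iff finite_subset)
  then have "(\<Sum>Q\<in>Pow P. random_subset_prob x P Q * real (card {X\<in>\<B>. X \<subseteq> Q})) =
      (\<Sum>Q\<in>Pow P. \<Sum>X\<in>\<B>. if X \<subseteq> Q then random_subset_prob x P Q else 0)"
    by (intro sum.cong refl) (simp add: sum.If_cases Int_def)
  also have "\<dots> = (\<Sum>X\<in>\<B>. \<Sum>Q\<in>Pow P. if X \<subseteq> Q then random_subset_prob x P Q else 0)"
    by (rule sum.swap)
  also have "\<dots> = (\<Sum>X\<in>\<B>. prod x X)"
    using assms by (intro sum.cong refl sum_random_subset_prob_supersets) auto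
  finally show ?thesis .
qed

lemma exists_greater_if_sum_greater:
  fixes f g :: "'a \<Rightarrow> 'b::linordered_semidom"
  assumes "sum f A < sum g A"
  shows "\<exists>x\<in>A. f x < g x"
  using sum_mono[of A g f] assms by (meson not_le)

text \<open>Compare the means of \<open>card {X \<in> \<B>. X \<subseteq> Q}\<close> and \<open>2 ^ card Q\<close> over the random set \<open>Q\<close>.\<close>

lemma exists_large_subset_with_many_members:
  fixes x :: "'a \<Rightarrow> real"
  assumes fin: "finite P" and x: "\<And>p. p \<in> P \<Longrightarrow> 0 \<le> x p \<and> x p \<le> 1"
    and B: "\<B> \<subseteq> Pow P" and large: "2 ^ (n + 1) < (\<Sum>X\<in>\<B>. prod x X)"
  obtains Q where "Q \<subseteq> P" "n \<le> card Q"
    "2 ^ card Q * (\<Sum>X\<in>\<B>. prod x X) \<le> 2 * real (card {X\<in>\<B>. X \<subseteq> Q}) * (\<Prod>p\<in>P. 1 + x p)"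
proof -
  define W Z where "W = (\<Sum>X\<in>\<B>. prod x X)" and "Z = (\<Prod>p\<in>P. 1 + x p)"
  let ?prob = "random_subset_prob x P" and ?members = "\<lambda>Q. {X\<in>\<B>. X \<subseteq> Q}"
  have Z: "Z > 0" unfolding Z_def using x by (intro prod_pos) force
  have W: "2 ^ (n + 1) < W" using large by (simp only: W_def)
  then have Wpos: "0 < W" using zero_less_power[of "2::real" "n + 1"] by linarith
  have total: "(\<Sum>Q\<in>Pow P. ?prob Q) = 1"
    using sum_random_subset_prob_prod[OF fin, of x "\<lambda>_. 1"] by simp
  have mean: "(\<Sum>Q\<in>Pow P. ?prob Q * 2 ^ card Q) = Z"
    using sum_random_subset_prob_prod[OF fin, of x "\<lambda>_. 2"] by (simp add: Z_def)
  have "(\<Sum>Q\<in>Pow P. ?prob Q * (2 ^ card Q * (W / (2 * Z)) + 2 ^ n)) =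
      (\<Sum>Q\<in>Pow P. ?prob Q * 2 ^ card Q) * (W / (2 * Z)) + (\<Sum>Q\<in>Pow P. ?prob Q) * 2 ^ n"
    by (simp add: distrib_left sum.distrib sum_distrib_right sum_divide_distrib mult.assoc)
  also have "\<dots> = W / 2 + 2 ^ n" using Z by (simp add: total mean)
  also have "\<dots> < (\<Sum>Q\<in>Pow P. ?prob Q * real (card (?members Q)))"
    using W by (simp add: sum_random_subset_prob_card_members[OF fin B] W_def)
  finally obtain Q where "Q \<in> Pow P"
    and less: "?prob Q * (2 ^ card Q * (W / (2 * Z)) + 2 ^ n) < ?prob Q * real (card (?members Q))"
    using exists_greater_if_sum_greater by blast
  then have Q: "Q \<subseteq> P" by simp
  have many: "2 ^ card Q * (W / (2 * Z)) + 2 ^ n < real (card (?members Q))"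
    using less random_subset_prob_nonneg[OF x Q] by (rule mult_left_less_imp_less)
  have "card (?members Q) \<le> card (Pow Q)"
    using finite_subset[OF Q fin] by (intro card_mono) auto
  then have "real (card (?members Q)) \<le> 2 ^ card Q"
    using finite_subset[OF Q fin] by (simp only: card_Pow of_nat_le_numeral_power_cancel_iff)
  moreover have "0 \<le> 2 ^ card Q * (W / (2 * Z))" using Wpos Z by simp
  ultimately have "(2::real) ^ n < 2 ^ card Q" using many by linarith
  then have "n \<le> card Q" by simp
  moreover have "2 ^ card Q * (W / (2 * Z)) \<le> real (card (?members Q))"
    using many zero_less_power[of "2::real" n] by linarith
  then have "2 ^ card Q * W \<le> 2 * real (card (?members Q)) * Z" using Z by (simp add: field_simps)
  ultimately show thesis unfolding W_def Z_def by (intro that[OF Q])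
qed

definition link :: "'a set set \<Rightarrow> 'a set \<Rightarrow> 'a set set" where
  "link \<F> T = {S. S \<inter> T = {} \<and> S \<union> T \<in> \<F>}"

lemma link_subset_Pow: "\<F> \<subseteq> Pow V \<Longrightarrow> link \<F> T \<subseteq> Pow (V - T)"
  unfolding link_def by auto

lemma union_free_link:
  assumes "union_free k \<F>"
  shows "union_free k (link \<F> T)"
proof (rule homogeneous_free_if_image)
  show "union_free k ((\<lambda>S. S \<union> T) ` link \<F> T)"
    using assms by (rule homogeneous_free_subset) (auto simp: link_def)
  show "inj_on (\<lambda>S. S \<union> T) (link \<F> T)" by (rule inj_onI) (auto simp: link_def)
  show "(S \<union> T) \<union> (S' \<union> T) = (S \<union> S') \<union> T" for S S' by blast
qed

lemma sum_Pow_power: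
  fixes a b :: "'b::comm_semiring_1"
  assumes "finite P"
  shows "(\<Sum>Q\<in>Pow P. a ^ card Q * b ^ card (P - Q)) = (a + b) ^ card P"
  using prod_add[OF assms, of "\<lambda>_. a" "\<lambda>_. b"] by simp

lemma sum_links:
  fixes a b :: "'b::comm_semiring_1"
  assumes "finite V" "\<F> \<subseteq> Pow V"
  shows "(\<Sum>T\<in>Pow V. a ^ card T * (\<Sum>S\<in>link \<F> T. b ^ card S)) = (\<Sum>X\<in>\<F>. (a + b) ^ card X)"
proof -
  have fin: "finite \<F>" "finite (link \<F> T)" for T
    using assms finite_subset[OF link_subset_Pow[OF assms(2)]]
    by (auto intro: finite_subset[OF assms(2)])
  have fin_mem: "finite X" if "X \<in> \<F>" for X
    using that assms by (auto intro: finite_subset)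
  have "(\<Sum>T\<in>Pow V. a ^ card T * (\<Sum>S\<in>link \<F> T. b ^ card S)) =
      (\<Sum>(T, S)\<in>Sigma (Pow V) (link \<F>). a ^ card T * b ^ card S)"
    using assms(1) fin(2) by (simp add: sum_distrib_left sum.Sigma)
  also have "\<dots> = (\<Sum>(X, T)\<in>Sigma \<F> Pow. a ^ card T * b ^ card (X - T))"
    using assms(2)
    by (intro sum.reindex_bij_witness
          [where i = "\<lambda>(X, T). (T, X - T)" and j = "\<lambda>(T, S). (S \<union> T, T)"])
      (auto simp: link_def Un_Diff Diff_triv Un_absorb2)
  also have "\<dots> = (\<Sum>X\<in>\<F>. \<Sum>T\<in>Pow X. a ^ card T * b ^ card (X - T))"
    using fin(1) fin_mem by (simp add: sum.Sigma)
  also have "\<dots> = (\<Sum>X\<in>\<F>. (a + b) ^ card X)"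
    using fin_mem by (intro sum.cong refl sum_Pow_power) auto
  finally show ?thesis .
qed

text \<open>If \<open>T\<close> has weight \<open>(1 - \<delta>) ^ card T\<close>, then the \<open>\<delta>\<close>-weights of the links add up to \<open>card \<F>\<close>,
  whereas the bounds \<open>(1 + \<delta>) ^ card (V - T)\<close> add up to \<open>2 ^ card V\<close>.\<close>

lemma exists_dense_link:
  fixes \<delta> \<rho> :: real
  assumes fin: "finite V" and F: "\<F> \<subseteq> Pow V" and \<delta>: "0 \<le> \<delta>" "\<delta> \<le> 1" and \<rho>: "\<rho> \<ge> 0"
    and card: "\<rho> * 2 ^ card V + (1 + \<delta>) ^ q * (2 - \<delta>) ^ card V < real (card \<F>)"
  obtains T where "T \<subseteq> V" "q \<le> card (V - T)"
    "\<rho> * (1 + \<delta>) ^ card (V - T) \<le> (\<Sum>S\<in>link \<F> T. \<delta> ^ card S)"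
proof -
  let ?bound = "\<lambda>T. \<rho> * (1 + \<delta>) ^ card (V - T) + (1 + \<delta>) ^ q"
  have "(\<Sum>T\<in>Pow V. (1 - \<delta>) ^ card T * ?bound T) =
      \<rho> * (\<Sum>T\<in>Pow V. (1 - \<delta>) ^ card T * (1 + \<delta>) ^ card (V - T)) +
      (1 + \<delta>) ^ q * (\<Sum>T\<in>Pow V. (1 - \<delta>) ^ card T * 1 ^ card (V - T))"
    by (simp add: distrib_left sum.distrib sum_distrib_left mult_ac)
  also have "\<dots> = \<rho> * 2 ^ card V + (1 + \<delta>) ^ q * (2 - \<delta>) ^ card V"
    by (simp only: sum_Pow_power[OF fin]) simp
  also have "\<dots> < (\<Sum>T\<in>Pow V. (1 - \<delta>) ^ card T * (\<Sum>S\<in>link \<F> T. \<delta> ^ card S))"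
    unfolding sum_links[OF fin F] using card by simp
  finally obtain T where T: "T \<subseteq> V"
    and less: "(1 - \<delta>) ^ card T * ?bound T < (1 - \<delta>) ^ card T * (\<Sum>S\<in>link \<F> T. \<delta> ^ card S)"
    by (auto dest: exists_greater_if_sum_greater)
  have dense: "?bound T < (\<Sum>S\<in>link \<F> T. \<delta> ^ card S)"
    using less by (rule mult_left_less_imp_less) (use \<delta>(2) in simp)
  have "(\<Sum>S\<in>link \<F> T. \<delta> ^ card S) \<le> (\<Sum>S\<in>Pow (V - T). \<delta> ^ card S)"
    using fin \<delta> link_subset_Pow[OF F] by (intro sum_mono2) auto
  also have "\<dots> = (1 + \<delta>) ^ card (V - T)"
    using sum_Pow_power[of "V - T" \<delta> 1] fin by (simp add: add.commute)
  moreover have "0 \<le> \<rho> * (1 + \<delta>) ^ card (V - T)" "0 \<le> (1 + \<delta>) ^ q" using \<delta> \<rho> by simp_all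
  ultimately have "(1 + \<delta>) ^ q < (1 + \<delta>) ^ card (V - T)"
    and "\<rho> * (1 + \<delta>) ^ card (V - T) \<le> (\<Sum>S\<in>link \<F> T. \<delta> ^ card S)" using dense by linarith+
  moreover from this(1) have "q \<le> card (V - T)"
    using \<delta>(1) power_increasing[of "card (V - T)" q "1 + \<delta>"] by (cases "q \<le> card (V - T)") auto
  ultimately show thesis using T that by blast
qed

section \<open>Uniform families\<close>

definition uniform_union_free :: "nat \<Rightarrow> nat \<Rightarrow> 'a set \<Rightarrow> 'a set set \<Rightarrow> bool" where
  "uniform_union_free k m V \<U> \<longleftrightarrow> \<U> \<subseteq> Pow V \<and> union_free k \<U> \<and> (\<forall>S\<in>\<U>. card S = m)"

lemma exists_dense_layer:
  fixes \<delta> :: real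
  assumes "finite V" "\<G> \<subseteq> Pow V"
  shows "\<exists>m. (\<Sum>S\<in>\<G>. \<delta> ^ card S) \<le> (real (card V) + 1) * (real (card {S\<in>\<G>. card S = m}) * \<delta> ^ m)"
proof (rule ccontr)
  assume "\<not> ?thesis"
  then have small: "(real (card V) + 1) * (real (card {S\<in>\<G>. card S = m}) * \<delta> ^ m) <
      (\<Sum>S\<in>\<G>. \<delta> ^ card S)" for m
    by (simp add: not_le)
  have "(real (card V) + 1) * (\<Sum>S\<in>\<G>. \<delta> ^ card S) =
      (real (card V) + 1) * (\<Sum>m\<le>card V. \<Sum>S | S \<in> \<G> \<and> card S = m. \<delta> ^ card S)"
    using assms finite_subset[OF assms(2)]
    by (subst sum.group) (auto intro: card_mono)
  also have "\<dots> = (\<Sum>m\<le>card V. (real (card V) + 1) * (real (card {S\<in>\<G>. card S = m}) * \<delta> ^ m))"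
    by (simp add: sum_distrib_left)
  also have "\<dots> < (\<Sum>m\<le>card V. \<Sum>S\<in>\<G>. \<delta> ^ card S)" using small by (intro sum_strict_mono) auto
  finally show False by (simp add: algebra_simps)
qed

lemma exists_dense_uniform_link:
  fixes \<delta> \<rho> :: real
  assumes fin: "finite V" and F: "\<F> \<subseteq> Pow V" "union_free k \<F>"
    and \<delta>: "0 \<le> \<delta>" "\<delta> \<le> 1" and \<rho>: "\<rho> \<ge> 0"
    and card: "\<rho> * 2 ^ card V + (1 + \<delta>) ^ q * (2 - \<delta>) ^ card V < real (card \<F>)"
  obtains V' m \<U> where "V' \<subseteq> V" "q \<le> card V'" "uniform_union_free k m V' \<U>"
    "\<rho> * (1 + \<delta>) ^ card V' \<le> (real (card V') + 1) * (real (card \<U>) * \<delta> ^ m)"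
proof -
  obtain T where T: "T \<subseteq> V" "q \<le> card (V - T)"
    "\<rho> * (1 + \<delta>) ^ card (V - T) \<le> (\<Sum>S\<in>link \<F> T. \<delta> ^ card S)"
    using exists_dense_link[OF fin F(1) \<delta> \<rho> card] .
  have link: "link \<F> T \<subseteq> Pow (V - T)" using F(1) by (rule link_subset_Pow)
  obtain m where m: "(\<Sum>S\<in>link \<F> T. \<delta> ^ card S) \<le>
      (real (card (V - T)) + 1) * (real (card {S\<in>link \<F> T. card S = m}) * \<delta> ^ m)"
    using exists_dense_layer[OF _ link, of \<delta>] fin by auto
  have "uniform_union_free k m (V - T) {S\<in>link \<F> T. card S = m}"
    using link homogeneous_free_subset[OF union_free_link[OF F(2), of T]]
    by (auto simp: uniform_union_free_def)
  then show thesis using T m by (intro that[of "V - T" m]) auto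
qed

text \<open>Without uniformity, \<open>S i = S j\<close> only forces the other members to be subsets of \<open>S i\<close>,
  and products of union-free families need not be union-free.\<close>

lemma uniform_union_free_imp_constant:
  assumes "uniform_union_free k m V \<U>" "finite V" "card I = k" "S ` I \<subseteq> \<U>"
    and union: "pairwise (\<lambda>i j. S i \<union> S j = U) I" and "i \<in> I" "j \<in> I"
  shows "S i = S j"
proof -
  have "\<not> inj_on S I"
    using assms(1,3,4) union
    by (intro homogeneous_free_imp_not_inj_on[where f = "(\<union>)"]) (auto simp: uniform_union_free_def)
  then obtain a b where ab: "a \<in> I" "b \<in> I" "a \<noteq> b" "S a = S b" unfolding inj_on_def by blast
  have "S l = S a" if "l \<in> I" for l
  proof (cases "l = a")
    case False
    have "S l \<union> S a = U" "S a \<union> S b = U" using pairwiseD(1)[OF union] ab(1-3) that False by metis+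
    then have "S l \<subseteq> S a" using ab(4) by auto
    moreover have "S l \<in> \<U>" "S a \<in> \<U>" using assms(4) that ab(1) by auto
    then have "card (S l) = card (S a)" "finite (S a)"
      using assms(1,2) by (auto simp: uniform_union_free_def intro: finite_subset)
    ultimately show ?thesis by (intro card_subset_eq)
  qed simp
  then show ?thesis using assms(6,7) by simp
qed

definition family_product :: "'i set \<Rightarrow> ('i \<Rightarrow> 'a set set) \<Rightarrow> ('i \<times> 'a) set set" where
  "family_product I \<U> = Sigma I ` Pi\<^sub>E I \<U>"

lemma Image_Sigma_singleton: "i \<in> I \<Longrightarrow> Sigma I c `` {i} = c i"
  by auto

lemma card_family_product:
  assumes "finite I"
  shows "card (family_product I \<U>) = (\<Prod>i\<in>I. card (\<U> i))"
proof -
  have "inj_on (Sigma I) (Pi\<^sub>E I \<U>)"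
  proof (rule inj_onI)
    fix c d assume "c \<in> Pi\<^sub>E I \<U>" "d \<in> Pi\<^sub>E I \<U>" "Sigma I c = Sigma I d"
    then show "c = d" using Image_Sigma_singleton[of _ I] by (metis PiE_ext)
  qed
  then show ?thesis by (simp add: family_product_def card_image card_PiE assms)
qed

lemma uniform_union_free_family_product:
  assumes "finite I" "k \<ge> 2"
    and fin: "\<And>i. i \<in> I \<Longrightarrow> finite (V i)"
    and unif: "\<And>i. i \<in> I \<Longrightarrow> uniform_union_free k (m i) (V i) (\<U> i)"
  shows "uniform_union_free k (\<Sum>i\<in>I. m i) (Sigma I V) (family_product I \<U>)"
proof -
  have slice: "S `` {i} \<in> \<U> i" if "S \<in> family_product I \<U>" "i \<in> I" for S i
    using that by (auto simp: family_product_def Image_Sigma_singleton)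
  have "union_free k (family_product I \<U>)"
    unfolding homogeneous_free_def
  proof (intro notI, elim exE conjE)
    fix B U assume B: "B \<subseteq> family_product I \<U>" "card B = k" "pairwise (\<lambda>S S'. S \<union> S' = U) B"
    have "S = S'" if S: "S \<in> B" "S' \<in> B" for S S'
    proof -
      have "S `` {i} = S' `` {i}" if "i \<in> I" for i
      proof (rule uniform_union_free_imp_constant[OF unif fin B(2)])
        show "(\<lambda>S. S `` {i}) ` B \<subseteq> \<U> i" using slice B(1) that by blast
        show "pairwise (\<lambda>S S'. S `` {i} \<union> S' `` {i} = U `` {i}) B"
          using B(3) by (rule pairwise_mono) auto
      qed (use that S in auto)
      moreover have "S \<subseteq> I \<times> UNIV" "S' \<subseteq> I \<times> UNIV"
        using S B(1) by (auto simp: family_product_def)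
      ultimately show "S = S'" by blast
    qed
    moreover have "finite B" using B(2) assms(2) by (intro card_ge_0_finite) simp
    ultimately have "card B \<le> 1" by (simp add: card_le_Suc0_iff_eq)
    then show False using B(2) assms(2) by simp
  qed
  moreover have "card (Sigma I c) = (\<Sum>i\<in>I. m i)" if "c \<in> Pi\<^sub>E I \<U>" for c
  proof -
    have "finite (c i) \<and> card (c i) = m i" if "i \<in> I" for i
      using unif[OF that] fin[OF that] PiE_mem[OF \<open>c \<in> Pi\<^sub>E I \<U>\<close> that]
      by (auto simp: uniform_union_free_def intro: finite_subset)
    then show ?thesis using assms(1) by simp
  qed
  moreover have "family_product I \<U> \<subseteq> Pow (Sigma I V)"
    using unif unfolding family_product_def uniform_union_free_def by (fastforce dest: PiE_mem)
  ultimately show ?thesis by (auto simp: uniform_union_free_def family_product_def)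
qed

section \<open>Dense uniform families from capacity 2\<close>

lemma one_plus_power_times_power_le_exp:
  fixes \<delta> :: real
  assumes "0 \<le> \<delta>" "\<delta> \<le> 1" "4 * q \<le> n"
  shows "(1 + \<delta>) ^ q * (2 - \<delta>) ^ n \<le> 2 ^ n * exp (- \<delta> / 4 * real n)"
proof -
  have "(1 + \<delta>) ^ q \<le> exp \<delta> ^ q" using assms(1) by (intro power_mono) auto
  also have "\<dots> = exp (\<delta> * real q)" by (simp add: exp_of_nat_mult[symmetric] mult.commute)
  also have "\<dots> \<le> exp (\<delta> * (real n / 4))"
    using assms(1,3) by (intro iffD2[OF exp_le_cancel_iff] mult_left_mono) auto
  finally have "(1 + \<delta>) ^ q \<le> exp (\<delta> * (real n / 4))" .
  moreover have "(2 - \<delta>) ^ n \<le> (2 * exp (- \<delta> / 2)) ^ n"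
    using assms(2) exp_ge_add_one_self[of "- \<delta> / 2"] by (intro power_mono) auto
  then have "(2 - \<delta>) ^ n \<le> 2 ^ n * exp (- \<delta> / 2 * real n)"
    by (simp add: power_mult_distrib exp_of_nat_mult[symmetric] mult.commute)
  ultimately have "(1 + \<delta>) ^ q * (2 - \<delta>) ^ n \<le>
      exp (\<delta> * (real n / 4)) * (2 ^ n * exp (- \<delta> / 2 * real n))"
    using assms by (intro mult_mono) auto
  also have "\<dots> = 2 ^ n * exp (\<delta> * (real n / 4) + - \<delta> / 2 * real n)"
    by (simp only: exp_add mult_ac)
  finally show ?thesis by (simp add: algebra_simps)
qed

lemma density_threshold_less:
  fixes \<delta> \<epsilon> :: real
  assumes "0 \<le> \<delta>" "\<delta> \<le> 1" "\<epsilon> \<le> \<delta> / 8" "4 * q \<le> n" and n: "2 < exp (\<delta> / 8 * real n)"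
  shows "exp (- \<epsilon> * real n) / 2 * 2 ^ n + (1 + \<delta>) ^ q * (2 - \<delta>) ^ n < (2 * exp (- \<epsilon>)) ^ n"
proof -
  have "2 * exp (- \<delta> / 4 * real n) < exp (\<delta> / 8 * real n) * exp (- \<delta> / 4 * real n)"
    using n by simp
  also have "\<dots> = exp (- (\<delta> / 8) * real n)" by (simp add: exp_add[symmetric] algebra_simps)
  also have "\<dots> \<le> exp (- \<epsilon> * real n)" using mult_right_mono[OF assms(3), of "real n"] by simp
  finally have "exp (- \<epsilon> * real n) / 2 * 2 ^ n + 2 ^ n * exp (- \<delta> / 4 * real n) <
      exp (- \<epsilon> * real n) * 2 ^ n"
    by (simp add: field_simps)
  also have "\<dots> = (2 * exp (- \<epsilon>)) ^ n"
    by (simp add: power_mult_distrib exp_of_nat_mult[symmetric] mult.commute)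
  finally show ?thesis
    using one_plus_power_times_power_le_exp[OF assms(1,2,4)] by linarith
qed

lemma exists_large_dense_uniform_union_free:
  fixes \<delta> \<epsilon> :: real
  assumes k: "k \<ge> 2" and cap: "sunflower_capacity k = 2"
    and \<delta>: "0 < \<delta>" "\<delta> \<le> 1" and \<epsilon>: "0 < \<epsilon>" "\<epsilon> \<le> \<delta> / 8"
  obtains V :: "nat set" and m \<U> where "finite V" "v \<le> card V" "uniform_union_free k m V \<U>"
    "exp (- \<epsilon> * (4 * real (card V) + 3)) * (1 + \<delta>) ^ card V \<le>
      2 * (real (card V) + 1) * (real (card \<U>) * \<delta> ^ m)"
proof -
  have "\<exists>\<^sub>F n in sequentially. (2 * exp (- \<epsilon>)) ^ n \<le> real (sunflower_free_max k n)"
    using \<epsilon>(1) cap by (intro frequently_sunflower_free_max_ge) auto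
  moreover have "\<forall>\<^sub>F n in sequentially. 2 < exp (\<delta> / 8 * real n) \<and> 4 * v \<le> n"
    using \<delta> by (intro eventually_conj eventually_ge_at_top) real_asymp
  ultimately obtain n where n: "(2 * exp (- \<epsilon>)) ^ n \<le> real (sunflower_free_max k n)"
    "2 < exp (\<delta> / 8 * real n)" "4 * v \<le> n"
    using frequently_ex[OF frequently_eventually_frequently] by blast
  obtain \<F> where F: "\<F> \<subseteq> Pow {1..n}" "union_free k \<F>" "card \<F> = sunflower_free_max k n"
    using obtain_union_free[OF k] .
  define \<rho> where "\<rho> = exp (- \<epsilon> * real n) / 2"
  have "\<rho> * 2 ^ card {1..n} + (1 + \<delta>) ^ (n div 4) * (2 - \<delta>) ^ card {1..n} < (2 * exp (- \<epsilon>)) ^ n"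
    using density_threshold_less[of \<delta> \<epsilon> "n div 4" n] \<delta> \<epsilon>(2) n(2) by (simp add: \<rho>_def)
  also have "\<dots> \<le> real (card \<F>)" using n(1) F(3) by simp
  finally obtain V m \<U> where V: "V \<subseteq> {1..n}" "n div 4 \<le> card V" and U: "uniform_union_free k m V \<U>"
    and dense: "\<rho> * (1 + \<delta>) ^ card V \<le> (real (card V) + 1) * (real (card \<U>) * \<delta> ^ m)"
    using exists_dense_uniform_link[of "{1..n}" \<F> k \<delta> \<rho> "n div 4"] F(1,2) \<delta> by (auto simp: \<rho>_def)
  have "real n \<le> 4 * real (card V) + 3" using V(2) by linarith
  then have "exp (- \<epsilon> * (4 * real (card V) + 3)) \<le> 2 * \<rho>"
    unfolding \<rho>_def using \<epsilon>(1) by simp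
  then have "exp (- \<epsilon> * (4 * real (card V) + 3)) * (1 + \<delta>) ^ card V \<le> 2 * \<rho> * (1 + \<delta>) ^ card V"
    using \<delta> by (intro mult_right_mono) auto
  also have "\<dots> \<le> 2 * (real (card V) + 1) * (real (card \<U>) * \<delta> ^ m)" using dense by linarith
  finally show thesis using V n(3) U by (intro that[of V m \<U>]) (auto intro: finite_subset)
qed

lemma exists_dense_uniform_union_free:
  fixes \<gamma> \<delta> :: real
  assumes k: "k \<ge> 2" and cap: "sunflower_capacity k = 2"
    and \<delta>: "0 < \<delta>" "\<delta> \<le> 1" and \<gamma>: "\<gamma> < ln (1 + \<delta>)"
  obtains V :: "nat set" and m \<U> where "finite V" "V \<noteq> {}" "uniform_union_free k m V \<U>"
    "exp (\<gamma> * real (card V)) \<le> real (card \<U>) * \<delta> ^ m"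
proof -
  define \<kappa> where "\<kappa> = ln (1 + \<delta>) - \<gamma>"
  define \<epsilon> where "\<epsilon> = min (\<delta> / 8) (\<kappa> / 8)"
  have \<kappa>: "\<kappa> > 0" using \<gamma> by (simp add: \<kappa>_def)
  have \<epsilon>: "\<epsilon> > 0" "\<epsilon> \<le> \<delta> / 8" "4 * \<epsilon> < \<kappa>" using \<delta> \<kappa> by (auto simp: \<epsilon>_def)
  have "\<forall>\<^sub>F v in sequentially. 2 * (real v + 1) * exp (\<epsilon> * (4 * real v + 3)) \<le> exp (\<kappa> * real v)"
    using \<epsilon>(1,3) by real_asymp
  then obtain v0 where v0:
    "\<And>v. v \<ge> v0 \<Longrightarrow> 2 * (real v + 1) * exp (\<epsilon> * (4 * real v + 3)) \<le> exp (\<kappa> * real v)"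
    by (auto simp: eventually_sequentially)
  obtain V :: "nat set" and m \<U> where V: "finite V" "Suc v0 \<le> card V"
    and U: "uniform_union_free k m V \<U>"
    and dense: "exp (- \<epsilon> * (4 * real (card V) + 3)) * (1 + \<delta>) ^ card V \<le>
      2 * (real (card V) + 1) * (real (card \<U>) * \<delta> ^ m)"
    using exists_large_dense_uniform_union_free[OF k cap \<delta> \<epsilon>(1,2)] .
  have "exp (\<gamma> * real (card V)) * (2 * (real (card V) + 1)) =
      exp (\<gamma> * real (card V)) * exp (- \<epsilon> * (4 * real (card V) + 3)) *
      (2 * (real (card V) + 1) * exp (\<epsilon> * (4 * real (card V) + 3)))"
    by (simp add: exp_minus)
  also have "\<dots> \<le> exp (\<gamma> * real (card V)) * exp (- \<epsilon> * (4 * real (card V) + 3)) *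
      exp (\<kappa> * real (card V))"
    using v0[of "card V"] V(2) by (intro mult_left_mono) auto
  also have "\<dots> = exp (- \<epsilon> * (4 * real (card V) + 3)) * (1 + \<delta>) ^ card V"
  proof -
    have "exp \<gamma> * exp \<kappa> = 1 + \<delta>" using \<delta> by (simp add: \<kappa>_def exp_add[symmetric])
    then show ?thesis by (simp add: exp_of_nat2_mult power_mult_distrib[symmetric] mult_ac)
  qed
  also note dense
  finally have "exp (\<gamma> * real (card V)) \<le> real (card \<U>) * \<delta> ^ m"
    by (simp add: mult.commute)
  then show thesis using V U by (intro that[of V m \<U>]) auto
qed

section \<open>Blow-ups\<close>

definition blow_up :: "('i \<Rightarrow> 'a set) \<Rightarrow> 'i set set \<Rightarrow> 'a set set" where
  "blow_up Q \<F> = (\<lambda>(S, c). c ` S) ` (SIGMA S:\<F>. Pi\<^sub>E S Q)"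

lemma transversal_Int_part:
  assumes "disjoint_family_on Q V" "S \<subseteq> V" "c \<in> Pi\<^sub>E S Q" "j \<in> V"
  shows "c ` S \<inter> Q j = (if j \<in> S then {c j} else {})"
proof -
  have "i = j" if "i \<in> S" "c i \<in> Q j" for i
    using assms that PiE_mem[OF assms(3) that(1)] unfolding disjoint_family_on_def by blast
  then show ?thesis using PiE_mem[OF assms(3)] by auto
qed

lemma blow_upE:
  assumes "X \<in> blow_up Q \<F>"
  obtains S c where "S \<in> \<F>" "c \<in> Pi\<^sub>E S Q" "X = c ` S"
  using assms by (auto simp: blow_up_def)

lemma blow_up_subset_card_le:
  assumes "finite V" "\<F> \<subseteq> Pow V" "\<And>j. j \<in> V \<Longrightarrow> Q j \<subseteq> P" "X \<in> blow_up Q \<F>"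
  shows "X \<subseteq> P" "card X \<le> card V"
proof -
  obtain S c where X: "S \<in> \<F>" "c \<in> Pi\<^sub>E S Q" "X = c ` S" using assms(4) by (rule blow_upE)
  have S: "S \<subseteq> V" "finite S" using X(1) assms(1,2) by (auto intro: finite_subset)
  then show "X \<subseteq> P" using X(3) PiE_mem[OF X(2)] assms(3) by blast
  have "card X \<le> card S" unfolding X(3) using S(2) by (rule card_image_le)
  also have "\<dots> \<le> card V" using assms(1) S(1) by (rule card_mono)
  finally show "card X \<le> card V" .
qed

definition parts_met :: "'i set \<Rightarrow> ('i \<Rightarrow> 'a set) \<Rightarrow> 'a set \<Rightarrow> 'i set" where
  "parts_met V Q X = {j\<in>V. X \<inter> Q j \<noteq> {}}"

lemma parts_met_Un: "parts_met V Q (X \<union> Y) = parts_met V Q X \<union> parts_met V Q Y"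
  unfolding parts_met_def by auto

lemma parts_met_transversal:
  assumes "disjoint_family_on Q V" "S \<subseteq> V" "c \<in> Pi\<^sub>E S Q"
  shows "parts_met V Q (c ` S) = S"
proof -
  have "c ` S \<inter> Q j \<noteq> {} \<longleftrightarrow> j \<in> S" if "j \<in> V" for j
    using transversal_Int_part[OF assms that] by simp
  then show ?thesis using assms(2) by (auto simp: parts_met_def)
qed

lemma inj_on_transversal_image:
  assumes "disjoint_family_on Q V" "\<F> \<subseteq> Pow V"
  shows "inj_on (\<lambda>(S, c). c ` S) (SIGMA S:\<F>. Pi\<^sub>E S Q)"
proof (rule inj_onI, clarify)
  fix S c S' c'
  assume S: "S \<in> \<F>" "c \<in> Pi\<^sub>E S Q" "S' \<in> \<F>" "c' \<in> Pi\<^sub>E S' Q" and image: "c ` S = c' ` S'"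
  have sub: "S \<subseteq> V" "S' \<subseteq> V" using S assms(2) by auto
  have "S = parts_met V Q (c ` S)" using parts_met_transversal[OF assms(1) sub(1) S(2)] ..
  also have "\<dots> = S'" unfolding image by (rule parts_met_transversal[OF assms(1) sub(2) S(4)])
  finally have same: "S = S'" .
  have "c j = c' j" if "j \<in> S" for j
  proof -
    have "j \<in> V" "j \<in> S'" using that sub(1) same by auto
    then show ?thesis
      using transversal_Int_part[OF assms(1) sub(1) S(2), of j]
        transversal_Int_part[OF assms(1) sub(2) S(4), of j] that image by simp
  qed
  then show "S = S' \<and> c = c'" using PiE_ext[OF S(2)] S(4) same by blast
qed

lemma parts_met_blow_up:
  assumes "disjoint_family_on Q V" "\<F> \<subseteq> Pow V" "X \<in> blow_up Q \<F>"
  shows "parts_met V Q X \<in> \<F>" "X \<subseteq> \<Union> (Q ` parts_met V Q X)"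
proof -
  obtain S c where X: "S \<in> \<F>" "c \<in> Pi\<^sub>E S Q" "X = c ` S" using assms(3) by (rule blow_upE)
  then have "S \<subseteq> V" using assms(2) by blast
  then have "parts_met V Q X = S" unfolding X(3) by (rule parts_met_transversal[OF assms(1) _ X(2)])
  then show "parts_met V Q X \<in> \<F>" "X \<subseteq> \<Union> (Q ` parts_met V Q X)"
    using X PiE_mem[OF X(2)] by auto
qed

lemma blow_up_Int_part_unique:
  assumes "disjoint_family_on Q V" "\<F> \<subseteq> Pow V" "X \<in> blow_up Q \<F>"
    and "j \<in> V" "p \<in> X \<inter> Q j" "q \<in> X \<inter> Q j"
  shows "p = q"
proof -
  obtain S c where X: "S \<in> \<F>" "c \<in> Pi\<^sub>E S Q" "X = c ` S" using assms(3) by (rule blow_upE)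
  have "S \<subseteq> V" using X(1) assms(2) by blast
  then show ?thesis
    using transversal_Int_part[OF assms(1) _ X(2) assms(4)] assms(5,6) X(3)
    by (auto split: if_splits)
qed

text \<open>If two members of a homogeneous set met the same parts but chose different points of one of
  them, then a third member would have to contain both points.\<close>

lemma union_free_blow_up:
  assumes disj: "disjoint_family_on Q V" and F: "\<F> \<subseteq> Pow V" "union_free k \<F>" and "k \<ge> 3"
  shows "union_free k (blow_up Q \<F>)"
  unfolding homogeneous_free_def
proof (intro notI, elim exE conjE)
  fix B U assume B: "B \<subseteq> blow_up Q \<F>" "card B = k" and union: "pairwise (\<lambda>X Y. X \<union> Y = U) B"
  let ?parts = "parts_met V Q"
  have "pairwise (\<lambda>X Y. ?parts X \<union> ?parts Y = ?parts U) B"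
    using union by (rule pairwise_mono) (auto simp: parts_met_Un[symmetric])
  moreover have "?parts ` B \<subseteq> \<F>" using parts_met_blow_up(1)[OF disj F(1)] B(1) by blast
  ultimately have "\<not> inj_on ?parts B"
    by (intro homogeneous_free_imp_not_inj_on[OF F(2) B(2)])
  then obtain X Y where XY: "X \<in> B" "Y \<in> B" "X \<noteq> Y" "?parts X = ?parts Y"
    unfolding inj_on_def by blast
  have "card {X, Y} < card B" using XY(3) B(2) assms(4) by simp
  then obtain Z where Z: "Z \<in> B" "Z \<noteq> X" "Z \<noteq> Y"
    using card_mono[of "{X, Y}" B] by fastforce
  have "X \<subseteq> Y" if XY: "X \<in> B" "Y \<in> B" "X \<noteq> Y" "?parts X = ?parts Y" "Z \<noteq> X" "Z \<noteq> Y" for X Y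
  proof
    fix p assume "p \<in> X"
    then obtain j where j: "j \<in> ?parts Y" "p \<in> Q j"
      using parts_met_blow_up(2)[OF disj F(1), of X] B(1) XY(1,4) by blast
    then obtain q where q: "q \<in> Y" "q \<in> Q j" "j \<in> V" by (auto simp: parts_met_def)
    note unique = blow_up_Int_part_unique[OF disj F(1) _ q(3), of _ p q]
    have "X \<union> Y = U" "Y \<union> Z = U" "X \<union> Z = U"
      using pairwiseD(1)[OF union] XY Z(1) by metis+
    then have "p \<in> Y \<or> p \<in> Z" "q \<in> X \<or> q \<in> Z" using \<open>p \<in> X\<close> q(1) by blast+
    moreover have "X \<in> blow_up Q \<F>" "Z \<in> blow_up Q \<F>" using B(1) XY(1) Z(1) by auto
    ultimately show "p \<in> Y"
      using unique[of X] unique[of Z] \<open>p \<in> X\<close> j(2) q by blast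
  qed
  then show False using XY Z by (metis subset_antisym)
qed

lemma sum_prod_blow_up:
  fixes w :: "'a \<Rightarrow> 'b::comm_semiring_1"
  assumes "finite V" "disjoint_family_on Q V" "\<F> \<subseteq> Pow V" "\<And>j. j \<in> V \<Longrightarrow> finite (Q j)"
  shows "(\<Sum>X\<in>blow_up Q \<F>. prod w X) = (\<Sum>S\<in>\<F>. \<Prod>j\<in>S. sum w (Q j))"
proof -
  have fin: "finite \<F>" "\<And>S. S \<in> \<F> \<Longrightarrow> finite S"
    using assms(1,3) by (meson finite_Pow_iff finite_subset, auto intro: finite_subset)
  have fin_Q: "finite (Q j)" if "S \<in> \<F>" "j \<in> S" for S j using that assms(3,4) by auto
  have "(\<Sum>X\<in>blow_up Q \<F>. prod w X) = (\<Sum>(S, c)\<in>(SIGMA S:\<F>. Pi\<^sub>E S Q). prod w (c ` S))"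
    unfolding blow_up_def by (subst sum.reindex[OF inj_on_transversal_image[OF assms(2,3)]])
      (simp add: case_prod_unfold)
  also have "\<dots> = (\<Sum>(S, c)\<in>(SIGMA S:\<F>. Pi\<^sub>E S Q). \<Prod>j\<in>S. w (c j))"
  proof (intro sum.cong refl, clarify)
    fix S c assume S: "S \<in> \<F>" "c \<in> Pi\<^sub>E S Q"
    have "S \<subseteq> V" using S(1) assms(3) by blast
    have "inj_on c S"
    proof (rule inj_onI)
      fix i j assume ij: "i \<in> S" "j \<in> S" "c i = c j"
      then have "c j \<in> Q i \<inter> Q j"
        using PiE_mem[OF S(2) ij(1)] PiE_mem[OF S(2) ij(2)] by simp
      then show "i = j"
        using ij(1,2) \<open>S \<subseteq> V\<close> assms(2) unfolding disjoint_family_on_def by blast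
    qed
    then show "prod w (c ` S) = (\<Prod>j\<in>S. w (c j))" by (simp add: prod.reindex)
  qed
  also have "\<dots> = (\<Sum>S\<in>\<F>. \<Sum>c\<in>Pi\<^sub>E S Q. \<Prod>j\<in>S. w (c j))"
    using fin fin_Q by (intro sum.Sigma[symmetric] ballI finite_PiE) auto
  also have "\<dots> = (\<Sum>S\<in>\<F>. \<Prod>j\<in>S. sum w (Q j))"
    using fin fin_Q by (intro sum.cong refl prod_sum_PiE[symmetric]) auto
  finally show ?thesis .
qed

lemma exists_subset_sum_between:
  fixes w :: "'a \<Rightarrow> real"
  assumes "finite X" "\<And>x. x \<in> X \<Longrightarrow> w x \<le> \<eta>" "\<delta> \<le> sum w X" "0 \<le> \<delta>" "0 \<le> \<eta>"
  shows "\<exists>Y\<subseteq>X. \<delta> \<le> sum w Y \<and> sum w Y \<le> \<delta> + \<eta>"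
  using assms
proof (induction X rule: finite_induct)
  case (insert x X)
  show ?case
  proof (cases "\<delta> \<le> sum w X")
    case True
    then show ?thesis using insert by (meson insertI2 subset_insertI2)
  next
    case False
    moreover have "w x \<le> \<eta>" using insert.prems(1) by simp
    ultimately have "sum w (insert x X) \<le> \<delta> + \<eta>" using insert.hyps by simp
    then show ?thesis using insert.prems by blast
  qed
qed auto

lemma exists_disjoint_subsets_sum_ge:
  fixes w :: "'a \<Rightarrow> real"
  assumes "finite I" "finite X" "\<And>x. x \<in> X \<Longrightarrow> w x \<le> \<eta>"
    "real (card I) * (\<delta> + \<eta>) \<le> sum w X" "0 \<le> \<delta>" "0 \<le> \<eta>"
  shows "\<exists>Q. (\<forall>i\<in>I. Q i \<subseteq> X \<and> \<delta> \<le> sum w (Q i)) \<and> disjoint_family_on Q I"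
  using assms
proof (induction I arbitrary: X rule: finite_induct)
  case (insert i I)
  have nonneg: "0 \<le> real (card I) * (\<delta> + \<eta>)" using insert.prems by simp
  have ge: "real (card I) * (\<delta> + \<eta>) + (\<delta> + \<eta>) \<le> sum w X"
    using insert.prems insert.hyps by (simp add: algebra_simps)
  then obtain Y where Y: "Y \<subseteq> X" "\<delta> \<le> sum w Y" "sum w Y \<le> \<delta> + \<eta>"
    using exists_subset_sum_between[of X w \<eta> \<delta>] insert.prems nonneg by auto
  have "sum w (X - Y) = sum w X - sum w Y" using Y(1) insert.prems by (intro sum_diff) auto
  then have "real (card I) * (\<delta> + \<eta>) \<le> sum w (X - Y)" using ge Y by linarith
  then have "\<exists>Q. (\<forall>i\<in>I. Q i \<subseteq> X - Y \<and> \<delta> \<le> sum w (Q i)) \<and> disjoint_family_on Q I"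
    using insert.prems by (intro insert.IH) auto
  then obtain Q where Q: "\<forall>i\<in>I. Q i \<subseteq> X - Y \<and> \<delta> \<le> sum w (Q i)" "disjoint_family_on Q I" by blast
  have "\<forall>j\<in>insert i I. (Q(i := Y)) j \<subseteq> X \<and> \<delta> \<le> sum w ((Q(i := Y)) j)"
    using Q(1) Y insert.hyps by auto
  moreover have "disjoint_family_on (Q(i := Y)) (insert i I)"
    using Q insert.hyps unfolding disjoint_family_on_def by (auto; blast)
  ultimately show ?case by blast
qed (simp add: disjoint_family_on_def)

section \<open>Integers as sets of primes\<close>

definition prime_sets :: "nat set set" where
  "prime_sets = {X. finite X \<and> (\<forall>p\<in>X. prime p)}"

lemma prime_factors_prod_primes:
  assumes "X \<in> prime_sets"
  shows "prime_factors (\<Prod>X) = X"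
proof -
  have "prime_factors (\<Prod>X) = (\<Union>p\<in>X. prime_factors p)"
    using assms by (subst prime_factors_prod) (auto simp: prime_sets_def)
  also have "\<dots> = (\<Union>p\<in>X. {p})"
    using assms by (intro SUP_cong refl prime_prime_factors) (auto simp: prime_sets_def)
  finally show ?thesis by simp
qed

lemma inj_on_prod_primes: "inj_on \<Prod> prime_sets"
  by (rule inj_on_inverseI) (rule prime_factors_prod_primes)

lemma prod_primes_pos: "X \<in> prime_sets \<Longrightarrow> 0 < \<Prod>X"
  by (intro prod_pos) (auto simp: prime_sets_def prime_gt_0_nat)

lemma lcm_prod_primes:
  assumes "X \<in> prime_sets" "Y \<in> prime_sets"
  shows "lcm (\<Prod>X) (\<Prod>Y) = \<Prod>(X \<union> Y)"
proof (rule dvd_antisym)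
  have fin: "finite X" "finite Y" using assms by (auto simp: prime_sets_def)
  show "lcm (\<Prod>X) (\<Prod>Y) dvd \<Prod>(X \<union> Y)"
    using fin by (intro lcm_least prod_dvd_prod_subset) auto
  have "coprime (\<Prod>X) (\<Prod>(Y - X))"
    using assms by (intro prod_coprime_left prod_coprime_right primes_coprime)
      (auto simp: prime_sets_def)
  moreover have "\<Prod>(Y - X) dvd \<Prod>Y" using fin by (intro prod_dvd_prod_subset) auto
  then have "\<Prod>(Y - X) dvd lcm (\<Prod>X) (\<Prod>Y)" by (rule dvd_trans) simp
  ultimately have "\<Prod>X * \<Prod>(Y - X) dvd lcm (\<Prod>X) (\<Prod>Y)" by (intro divides_mult) auto
  also have "\<Prod>X * \<Prod>(Y - X) = \<Prod>(X \<union> (Y - X))"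
    using fin by (intro prod.union_disjoint[symmetric]) auto
  finally show "\<Prod>(X \<union> Y) dvd lcm (\<Prod>X) (\<Prod>Y)" by simp
qed

lemma lcm_free_prod_primes:
  assumes "\<X> \<subseteq> prime_sets" "union_free k \<X>"
  shows "lcm_free k (\<Prod> ` \<X>)"
  unfolding lcm_free_iff_homogeneous_free
proof (rule homogeneous_free_if_image)
  have "prime_factors ` \<Prod> ` \<X> = (\<lambda>X. X) ` \<X>"
    unfolding image_image using assms(1) by (intro image_cong refl prime_factors_prod_primes) auto
  then show "union_free k (prime_factors ` \<Prod> ` \<X>)" using assms(2) by simp
  show "inj_on prime_factors (\<Prod> ` \<X>)"
    using assms(1) by (intro inj_on_inverseI[where g = "\<Prod>"]) (auto simp: prime_factors_prod_primes)
  show "prime_factors a \<union> prime_factors b = prime_factors (lcm a b)"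
    if "a \<in> \<Prod> ` \<X>" "b \<in> \<Prod> ` \<X>" for a b
    using that assms(1) prod_primes_pos by (subst prime_factors_lcm) auto
qed

definition square_class :: "nat \<Rightarrow> nat set \<Rightarrow> nat set set" where
  "square_class s A = {X \<in> prime_sets. s\<^sup>2 * \<Prod>X \<in> A}"

lemma union_free_square_class:
  assumes "lcm_free k A" "s > 0"
  shows "union_free k (square_class s A)"
proof (rule homogeneous_free_if_image)
  show "homogeneous_free lcm k ((\<lambda>X. s\<^sup>2 * \<Prod>X) ` square_class s A)"
    using assms(1) unfolding lcm_free_iff_homogeneous_free
    by (rule homogeneous_free_subset) (auto simp: square_class_def)
  show "inj_on (\<lambda>X. s\<^sup>2 * \<Prod>X) (square_class s A)"
    using assms(2) inj_on_prod_primes by (auto simp: inj_on_def square_class_def)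
  show "lcm (s\<^sup>2 * \<Prod>X) (s\<^sup>2 * \<Prod>Y) = s\<^sup>2 * \<Prod>(X \<union> Y)"
    if "X \<in> square_class s A" "Y \<in> square_class s A" for X Y
    using that by (simp add: lcm_mult_left lcm_prod_primes square_class_def)
qed

lemma exists_square_class:
  assumes "n > 0"
  obtains s X where "s > 0" "X \<in> prime_sets" "n = s\<^sup>2 * \<Prod>X"
proof
  let ?r = "squarefree_part n" and ?s = "square_part n"
  have "?r = (\<Prod>p\<in>prime_factors ?r. p ^ multiplicity p ?r)"
    using prod_prime_factors[of ?r] by simp
  also have "\<dots> = \<Prod>(prime_factors ?r)"
    using squarefree_squarefree_part[of n] squarefree_factorial_semiring'[of ?r]
    by (intro prod.cong) auto
  finally show "n = ?s\<^sup>2 * \<Prod>(prime_factors ?r)"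
    using squarefree_decompose[of n] by (simp add: mult.commute)
  show "?s > 0" by (rule ccontr) (use assms in simp)
  show "prime_factors ?r \<in> prime_sets" by (auto simp: prime_sets_def)
qed

definition primes_le :: "nat \<Rightarrow> nat set" where
  "primes_le N = {p. prime p \<and> p \<le> N}"

lemma finite_primes_le [simp]: "finite (primes_le N)"
  unfolding primes_le_def by simp

lemma subset_primes_le_imp_prime_sets: "X \<subseteq> primes_le N \<Longrightarrow> X \<in> prime_sets"
  using finite_subset[OF _ finite_primes_le] by (auto simp: prime_sets_def primes_le_def)

lemma prod_square_class_le:
  assumes "A \<subseteq> {1..N}" "s > 0" "X \<in> square_class s A"
  shows "\<Prod>X \<le> N"
proof -
  have "1 * \<Prod>X \<le> s\<^sup>2 * \<Prod>X" using assms(2) by (intro mult_right_mono) auto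
  also have "\<dots> \<le> N" using assms(1,3) by (auto simp: square_class_def)
  finally show ?thesis by simp
qed

lemma square_class_subset_Pow:
  assumes "A \<subseteq> {1..N}" "s > 0"
  shows "square_class s A \<subseteq> Pow (primes_le N)"
proof (intro subsetI PowI)
  fix X p assume X: "X \<in> square_class s A" and p: "p \<in> X"
  then have prime_set: "X \<in> prime_sets" by (simp add: square_class_def)
  then have "p dvd \<Prod>X" using p dvd_prodI[of X p "\<lambda>p. p"] by (simp add: prime_sets_def)
  then have "p \<le> N"
    using prod_primes_pos[OF prime_set] prod_square_class_le[OF assms X]
    by (meson dvd_imp_le le_trans)
  then show "p \<in> primes_le N" using prime_set p by (simp add: primes_le_def prime_sets_def)
qed

lemma finite_square_class: "A \<subseteq> {1..N} \<Longrightarrow> s > 0 \<Longrightarrow> finite (square_class s A)"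
  by (rule finite_subset[OF square_class_subset_Pow]) simp_all

section \<open>Reciprocal sums\<close>

lemma sum_inverse_le_sum_square_classes:
  assumes "A \<subseteq> {1..N}"
  shows "(\<Sum>a\<in>A. 1 / real a) \<le> (\<Sum>s=1..N. 1 / (real s)\<^sup>2 * (\<Sum>X\<in>square_class s A. 1 / real (\<Prod>X)))"
proof -
  let ?D = "SIGMA s:{1..N}. square_class s A"
  let ?value = "\<lambda>(s, X). s\<^sup>2 * \<Prod>X :: nat"
  have fin: "finite ?D" using finite_square_class[OF assms] by (intro finite_SigmaI) auto
  have "A \<subseteq> ?value ` ?D"
  proof
    fix a assume "a \<in> A"
    then have a: "0 < a" "a \<le> N" using assms by auto
    from a(1) obtain s X where sX: "s > 0" "X \<in> prime_sets" "a = s\<^sup>2 * \<Prod>X"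
      by (rule exists_square_class)
    have "s dvd a" unfolding sX(3) by (simp add: power2_eq_square)
    then have "s \<le> N" using a dvd_imp_le le_trans by blast
    then have "(s, X) \<in> ?D" using sX \<open>a \<in> A\<close> by (simp add: square_class_def)
    then show "a \<in> ?value ` ?D" by (rule image_eqI[rotated]) (simp add: sX(3))
  qed
  then have "(\<Sum>a\<in>A. 1 / real a) \<le> (\<Sum>a\<in>?value ` ?D. 1 / real a)"
    using fin by (intro sum_mono2) auto
  also have "\<dots> \<le> (\<Sum>z\<in>?D. 1 / real (?value z))"
    using sum_image_le[OF fin, of "\<lambda>a. 1 / real a" ?value] by (simp add: o_def)
  also have "\<dots> = (\<Sum>s=1..N. \<Sum>X\<in>square_class s A. 1 / real (s\<^sup>2 * \<Prod>X))"
    using finite_square_class[OF assms] by (subst sum.Sigma) (auto intro!: sum.cong)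
  finally show ?thesis by (simp add: sum_distrib_left)
qed

lemma sum_inverse_squares_le_2: "(\<Sum>s=1..N. 1 / (real s)\<^sup>2) \<le> 2"
proof -
  have "(\<Sum>s=1..N. 1 / (real s)\<^sup>2) = (\<Sum>s<N. 1 / (real s + 1)\<^sup>2)"
    by (rule sum.reindex_bij_witness[where i = Suc and j = "\<lambda>s. s - 1"]) auto
  also have "\<dots> \<le> (\<Sum>s. 1 / (real s + 1)\<^sup>2)"
    using inverse_squares_sums by (intro sum_le_suminf) (auto simp: sums_iff add.commute)
  also have "\<dots> = pi\<^sup>2 / 6" using inverse_squares_sums by (simp add: sums_iff add.commute)
  also have "\<dots> \<le> 3.2\<^sup>2 / 6"
    using pi_approx(2) by (intro divide_right_mono power_mono) auto
  finally show ?thesis by (simp add: power2_eq_square)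
qed

lemma exists_square_class_sum_ge:
  assumes "A \<subseteq> {1..N}" "N \<ge> 1"
  obtains s where "s \<in> {1..N}" "(\<Sum>a\<in>A. 1 / real a) \<le> 2 * (\<Sum>X\<in>square_class s A. 1 / real (\<Prod>X))"
proof (rule ccontr)
  assume no_class: "\<not> thesis"
  define f where "f = (\<Sum>a\<in>A. 1 / real a)"
  have "f \<ge> 0" unfolding f_def by (intro sum_nonneg) auto
  have "f \<le> (\<Sum>s=1..N. 1 / (real s)\<^sup>2 * (\<Sum>X\<in>square_class s A. 1 / real (\<Prod>X)))"
    unfolding f_def by (rule sum_inverse_le_sum_square_classes[OF assms(1)])
  also have "\<dots> < (\<Sum>s=1..N. 1 / (real s)\<^sup>2 * (f / 2))"
    using no_class that assms(2) unfolding f_def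
    by (intro sum_strict_mono mult_strict_left_mono) force+
  also have "\<dots> = (\<Sum>s=1..N. 1 / (real s)\<^sup>2) * (f / 2)" by (simp only: sum_distrib_right)
  also have "\<dots> \<le> 2 * (f / 2)"
    using \<open>f \<ge> 0\<close> by (intro mult_right_mono sum_inverse_squares_le_2) simp
  finally show False by simp
qed

lemma sum_inverse_primes_ge:
  assumes "N \<ge> 1"
  shows "ln (ln (real N + 1)) - ln 2 \<le> (\<Sum>p\<in>primes_le N. 1 / real p)"
proof -
  let ?P = "primes_le N"
  obtain s where s: "s \<in> {1..N}"
    "(\<Sum>a=1..N. 1 / real a) \<le> 2 * (\<Sum>X\<in>square_class s {1..N}. 1 / real (\<Prod>X))"
    using exists_square_class_sum_ge[of "{1..N}" N] assms by auto
  have "ln (real N + 1) \<le> (\<Sum>a=1..N. 1 / real a)"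
    using ln_le_harm[of N] by (simp add: harm_def inverse_eq_divide)
  also note s(2)
  also have "(\<Sum>X\<in>square_class s {1..N}. 1 / real (\<Prod>X)) \<le> (\<Sum>X\<in>Pow ?P. 1 / real (\<Prod>X))"
    using s(1) square_class_subset_Pow[of "{1..N}" N s]
    by (intro sum_mono2) (auto intro!: divide_nonneg_nonneg prod_nonneg)
  also have "\<dots> = (\<Prod>p\<in>?P. 1 + 1 / real p)"
    using prod_add[OF finite_primes_le, of "\<lambda>p. 1 / real p" "\<lambda>_. 1" N]
    by (simp add: prod_dividef add.commute)
  also have "\<dots> \<le> (\<Prod>p\<in>?P. exp (1 / real p))" by (intro prod_mono) auto
  also have "\<dots> = exp (\<Sum>p\<in>?P. 1 / real p)" by (simp add: exp_sum)
  finally have "ln (real N + 1) / 2 \<le> exp (\<Sum>p\<in>?P. 1 / real p)" by simp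
  then have "ln (ln (real N + 1) / 2) \<le> ln (exp (\<Sum>p\<in>?P. 1 / real p))"
    using assms by (intro ln_mono) auto
  then show ?thesis using assms by (simp add: ln_div)
qed

lemma sum_inverse_large_primes_ge:
  assumes "N \<ge> 1"
  shows "ln (ln (real N + 1)) - ln 2 - real K \<le> (\<Sum>p\<in>primes_le N - {..K}. 1 / real p)"
proof -
  have "(\<Sum>p\<in>primes_le N \<inter> {..K}. 1 / real p) \<le> (\<Sum>p\<in>primes_le N \<inter> {..K}. 1)"
    by (intro sum_mono) (auto simp: primes_le_def dest: prime_ge_1_nat)
  also have "\<dots> \<le> real K"
    using card_mono[of "{1..K}" "primes_le N \<inter> {..K}"]
    by (fastforce simp: primes_le_def dest: prime_ge_1_nat)
  finally have "(\<Sum>p\<in>primes_le N \<inter> {..K}. 1 / real p) \<le> real K" .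
  moreover have "(\<Sum>p\<in>primes_le N. 1 / real p) =
      (\<Sum>p\<in>primes_le N \<inter> {..K}. 1 / real p) + (\<Sum>p\<in>primes_le N - {..K}. 1 / real p)"
    by (rule sum.Int_Diff) simp
  ultimately show ?thesis using sum_inverse_primes_ge[OF assms] by linarith
qed

lemma powr_minus_diff_ge:
  fixes a t :: real
  assumes "0 < a" "0 < t"
  shows "t * (a + 1) powr (- (1 + t)) \<le> a powr (- t) - (a + 1) powr (- t)"
proof -
  have "ln (a / (a + 1)) \<le> a / (a + 1) - 1" using assms(1) by (intro ln_le_minus_one) auto
  then have "1 / (a + 1) \<le> ln ((a + 1) / a)" using assms(1) by (simp add: ln_div field_simps)
  then have "1 + t * (1 / (a + 1)) \<le> 1 + t * ln ((a + 1) / a)"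
    using assms(2) by (intro add_left_mono mult_left_mono) auto
  also have "\<dots> \<le> ((a + 1) / a) powr t" using assms(1) by (simp add: powr_def)
  finally have "(a + 1) powr (- t) * (1 + t * (1 / (a + 1))) \<le>
      (a + 1) powr (- t) * ((a + 1) / a) powr t"
    by (intro mult_left_mono) auto
  also have "\<dots> = a powr (- t)" using assms(1) by (simp add: powr_divide powr_minus field_simps)
  finally have "(a + 1) powr (- t) * (t * (1 / (a + 1))) \<le> a powr (- t) - (a + 1) powr (- t)"
    by (simp add: distrib_left)
  moreover have "(a + 1) powr (- t) * (t * (1 / (a + 1))) = t * (a + 1) powr (- (1 + t))"
    using assms(1) by (simp add: powr_diff powr_minus field_simps)
  ultimately show ?thesis by simp
qed

lemma sum_powr_le:
  fixes t :: real
  assumes "t > 0"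
  shows "(\<Sum>n=1..M. real n powr (- (1 + t))) \<le> 1 + 1 / t"
proof -
  have "t * (\<Sum>n=1..Suc m. real n powr (- (1 + t))) \<le> t + 1 - real (Suc m) powr (- t)" for m
  proof (induction m)
    case (Suc m)
    then show ?case
      using powr_minus_diff_ge[of "real (Suc m)" t] assms by (simp add: distrib_left add_ac)
  qed simp
  moreover have "t + 1 - real (Suc m) powr (- t) \<le> t + 1" for m by simp
  ultimately have "t * (\<Sum>n=1..Suc m. real n powr (- (1 + t))) \<le> t + 1" for m
    using order_trans by blast
  then have "(\<Sum>n=1..Suc m. real n powr (- (1 + t))) \<le> (t + 1) / t" for m
    using assms by (subst pos_le_divide_eq) (simp_all only: mult.commute)
  also have "(t + 1) / t = 1 + 1 / t" using assms by (simp add: add_divide_distrib)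
  finally show ?thesis using assms by (cases M) simp_all
qed

lemma prod_primes_powr_le:
  fixes t :: real
  assumes "t > 0"
  shows "(\<Prod>p\<in>primes_le N. 1 + real p powr (- (1 + t))) \<le> 1 + 1 / t"
proof -
  let ?P = "primes_le N"
  have sets: "Pow ?P \<subseteq> prime_sets" by (intro subsetI) (simp add: subset_primes_le_imp_prime_sets)
  have "(\<Prod>p\<in>?P. 1 + real p powr (- (1 + t))) = (\<Sum>X\<in>Pow ?P. \<Prod>p\<in>X. real p powr (- (1 + t)))"
    using prod_add[OF finite_primes_le, of "\<lambda>p. real p powr (- (1 + t))" "\<lambda>_. 1" N]
    by (simp add: add.commute)
  also have "\<dots> = (\<Sum>X\<in>Pow ?P. real (\<Prod>X) powr (- (1 + t)))"
    by (intro sum.cong refl) (simp add: prod_powr_distrib)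
  also have "\<dots> = (\<Sum>n\<in>\<Prod> ` Pow ?P. real n powr (- (1 + t)))"
    by (subst sum.reindex[OF inj_on_subset[OF inj_on_prod_primes sets]]) simp
  also have "\<dots> \<le> (\<Sum>n=1..Max (\<Prod> ` Pow ?P). real n powr (- (1 + t)))"
  proof (rule sum_mono2)
    have "1 \<le> \<Prod>X" "\<Prod>X \<le> Max (\<Prod> ` Pow ?P)" if "X \<in> Pow ?P" for X
      using prod_primes_pos[of X] that sets Max_ge[of "\<Prod> ` Pow ?P" "\<Prod>X"] by (auto simp: Suc_le_eq)
    then show "\<Prod> ` Pow ?P \<subseteq> {1..Max (\<Prod> ` Pow ?P)}" by (intro image_subsetI) simp
  qed auto
  also have "\<dots> \<le> 1 + 1 / t" by (rule sum_powr_le) fact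
  finally show ?thesis .
qed

section \<open>Upper bounds for LCM-free sets\<close>

lemma lcm_free_max_ge:
  assumes "A \<subseteq> {1..N}" "lcm_free k A"
  shows "(\<Sum>a\<in>A. 1 / real a) \<le> lcm_free_max k N"
  unfolding lcm_free_max_def by (rule Max_ge[OF finite_lcm_free_sums]) (use assms in blast)

lemma obtain_lcm_free_max:
  assumes "k \<ge> 1"
  obtains A where "A \<subseteq> {1..N}" "lcm_free k A" "(\<Sum>a\<in>A. 1 / real a) = lcm_free_max k N"
proof -
  let ?M = "{(\<Sum>a\<in>A. 1 / real a) | A. A \<subseteq> {1..N} \<and> lcm_free k A}"
  have "(\<Sum>a\<in>{}. 1 / real a) \<in> ?M" using lcm_free_empty[OF assms] by blast
  then have "Max ?M \<in> ?M" by (intro Max_in[OF finite_lcm_free_sums]) blast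
  then obtain A where "A \<subseteq> {1..N}" "lcm_free k A" "(\<Sum>a\<in>A. 1 / real a) = Max ?M"
    unfolding mem_Collect_eq by metis
  then show thesis using that unfolding lcm_free_max_def by blast
qed

lemma lcm_free_max_ge_1:
  assumes "k \<ge> 2" "N \<ge> 1"
  shows "1 \<le> lcm_free_max k N"
proof -
  have "lcm_free k {1}"
    using assms(1) by (simp add: lcm_free_iff_homogeneous_free homogeneous_free_if_card_less)
  then show ?thesis using lcm_free_max_ge[of "{1}" N k] assms(2) by simp
qed

lemma lcm_free_max_le:
  assumes "k \<ge> 1" "N \<ge> 1"
  shows "lcm_free_max k N \<le> 1 + ln (real N)"
proof -
  obtain A where A: "A \<subseteq> {1..N}" "(\<Sum>a\<in>A. 1 / real a) = lcm_free_max k N"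
    using obtain_lcm_free_max[OF assms(1)] by metis
  have "(\<Sum>a\<in>A. 1 / real a) \<le> (\<Sum>a=1..N. 1 / real a)" using A(1) by (intro sum_mono2) auto
  also have "\<dots> = harm N" by (simp add: harm_def inverse_eq_divide)
  also have "\<dots> \<le> 1 + ln (real N)"
    using euler_mascheroni_sequence_decreasing[of 1 N] assms(2) by (simp add: harm_def)
  finally show ?thesis using A(2) by simp
qed

text \<open>Raising the exponent to \<open>1 + 1 / ln N\<close> costs only a constant factor below \<open>N\<close> and makes the
  Euler product over the primes of order \<open>ln N\<close>.\<close>

lemma inverse_le_3_powr:
  fixes M y :: real
  assumes "1 < M" "1 \<le> y" "y \<le> M"
  shows "1 / y \<le> 3 * y powr (- (1 + 1 / ln M))"
proof -
  have "y powr (1 / ln M) = exp (ln y / ln M)" using assms by (simp add: powr_def)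
  also have "\<dots> \<le> exp 1" using assms by (intro iffD2[OF exp_le_cancel_iff]) simp
  also have "\<dots> \<le> 3" by (rule exp_le)
  finally have "y powr (- (1 + 1 / ln M)) * y powr (1 / ln M) \<le> y powr (- (1 + 1 / ln M)) * 3"
    by (rule mult_left_mono) simp
  moreover have "y powr (- (1 + 1 / ln M)) * y powr (1 / ln M) = 1 / y"
    using assms by (simp add: powr_add[symmetric] powr_minus_divide)
  ultimately show ?thesis by (simp add: mult.commute)
qed

definition prime_prob :: "nat \<Rightarrow> nat \<Rightarrow> real" where
  "prime_prob N p = real p powr (- (1 + 1 / ln (real N)))"

lemma prime_prob_bounds:
  assumes "N \<ge> 2" "p \<ge> 1"
  shows "0 \<le> prime_prob N p \<and> prime_prob N p \<le> 1"
proof -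
  have "0 \<le> 1 / ln (real N)" using assms(1) by simp
  then have "- (1 + 1 / ln (real N)) \<le> 0" by linarith
  then have "prime_prob N p \<le> real p powr 0"
    unfolding prime_prob_def using assms(2) by (intro powr_mono) auto
  then show ?thesis using assms(2) by (simp add: prime_prob_def)
qed

lemma prod_prime_prob_le:
  assumes "N \<ge> 2"
  shows "(\<Prod>p\<in>primes_le N. 1 + prime_prob N p) \<le> 1 + ln (real N)"
  using prod_primes_powr_le[of "1 / ln (real N)" N] assms by (simp add: prime_prob_def)

lemma obtain_heavy_union_free_prime_sets:
  assumes "k \<ge> 1" "N \<ge> 2"
  obtains \<B> where "\<B> \<subseteq> Pow (primes_le N)" "union_free k \<B>"
    "lcm_free_max k N \<le> 6 * (\<Sum>X\<in>\<B>. prod (prime_prob N) X)"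
proof -
  have "N \<ge> 1" using assms(2) by simp
  obtain A where A: "A \<subseteq> {1..N}" "lcm_free k A" "(\<Sum>a\<in>A. 1 / real a) = lcm_free_max k N"
    using obtain_lcm_free_max[OF assms(1)] .
  obtain s where s: "s \<in> {1..N}"
    "(\<Sum>a\<in>A. 1 / real a) \<le> 2 * (\<Sum>X\<in>square_class s A. 1 / real (\<Prod>X))"
    using exists_square_class_sum_ge[OF A(1) \<open>N \<ge> 1\<close>] .
  have "1 / real (\<Prod>X) \<le> 3 * prod (prime_prob N) X" if "X \<in> square_class s A" for X
  proof -
    have "1 \<le> \<Prod>X" "\<Prod>X \<le> N"
      using that s(1) prod_primes_pos[of X] prod_square_class_le[OF A(1), of s X]
      by (auto simp: square_class_def Suc_le_eq)
    then have "1 \<le> real (\<Prod>X)" "real (\<Prod>X) \<le> real N"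
      by (simp_all only: real_of_nat_ge_one_iff of_nat_le_iff)
    then have "1 / real (\<Prod>X) \<le> 3 * real (\<Prod>X) powr (- (1 + 1 / ln (real N)))"
      using assms(2) by (intro inverse_le_3_powr) simp_all
    then show ?thesis by (simp add: prime_prob_def[abs_def] prod_powr_distrib)
  qed
  then have "(\<Sum>X\<in>square_class s A. 1 / real (\<Prod>X)) \<le>
      3 * (\<Sum>X\<in>square_class s A. prod (prime_prob N) X)"
    unfolding sum_distrib_left by (rule sum_mono)
  then have "lcm_free_max k N \<le> 6 * (\<Sum>X\<in>square_class s A. prod (prime_prob N) X)"
    using s(2) A(3) by linarith
  then show thesis
    using square_class_subset_Pow[OF A(1), of s] union_free_square_class[OF A(2), of s] s(1)
    by (intro that) auto
qed

lemma exists_sunflower_free_max_ge_lcm_free_max: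
  assumes k: "k \<ge> 2" and N: "N \<ge> 2" and large: "12 * 2 ^ n < lcm_free_max k N"
  obtains q where "n \<le> q"
    "2 ^ q * lcm_free_max k N \<le> 12 * (1 + ln (real N)) * real (sunflower_free_max k q)"
proof -
  let ?Z = "\<Prod>p\<in>primes_le N. 1 + prime_prob N p"
  have "k \<ge> 1" using k by simp
  then obtain \<B> where B: "\<B> \<subseteq> Pow (primes_le N)" "union_free k \<B>"
    and weight: "lcm_free_max k N \<le> 6 * (\<Sum>X\<in>\<B>. prod (prime_prob N) X)"
    using N by (rule obtain_heavy_union_free_prime_sets)
  have "0 \<le> prime_prob N p \<and> prime_prob N p \<le> 1" if "p \<in> primes_le N" for p
    using that prime_ge_1_nat[of p] by (intro prime_prob_bounds N) (simp add: primes_le_def)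
  moreover have "2 ^ (n + 1) < (\<Sum>X\<in>\<B>. prod (prime_prob N) X)" using weight large by simp
  ultimately obtain Q where Q: "Q \<subseteq> primes_le N" "n \<le> card Q"
    and many: "2 ^ card Q * (\<Sum>X\<in>\<B>. prod (prime_prob N) X) \<le> 2 * real (card {X\<in>\<B>. X \<subseteq> Q}) * ?Z"
    by (rule exists_large_subset_with_many_members[OF finite_primes_le _ B(1)])
  have "union_free k {X\<in>\<B>. X \<subseteq> Q}" by (rule homogeneous_free_subset[OF B(2)]) simp
  then have "card {X\<in>\<B>. X \<subseteq> Q} \<le> sunflower_free_max k (card Q)"
    using Q(1) k by (intro card_le_sunflower_free_max) (auto intro: finite_subset)
  then have "2 * real (card {X\<in>\<B>. X \<subseteq> Q}) * ?Z \<le>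
      2 * real (sunflower_free_max k (card Q)) * (1 + ln (real N))"
    using prod_prime_prob_le[OF N]
    by (intro mult_mono) (auto simp: prime_prob_def intro!: prod_nonneg)
  moreover have "2 ^ card Q * lcm_free_max k N \<le> 6 * (2 ^ card Q * (\<Sum>X\<in>\<B>. prod (prime_prob N) X))"
    using mult_left_mono[OF weight, of "2 ^ card Q"] by simp
  ultimately show thesis using many by (intro that[OF Q(2)]) argo
qed

lemma lcm_free_max_le_if_sunflower_free_max_le:
  assumes k: "k \<ge> 2" and N: "N \<ge> 2" and z: "0 \<le> z" "z \<le> 2"
    and sunflower: "\<And>q. q \<ge> n \<Longrightarrow> real (sunflower_free_max k q) \<le> z ^ q"
  shows "lcm_free_max k N \<le> max (12 * 2 ^ n) (12 * (1 + ln (real N)) * (z / 2) ^ n)"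
proof (cases "12 * 2 ^ n < lcm_free_max k N")
  case True
  obtain q where q: "n \<le> q"
    "2 ^ q * lcm_free_max k N \<le> 12 * (1 + ln (real N)) * real (sunflower_free_max k q)"
    using exists_sunflower_free_max_ge_lcm_free_max[OF k N True] .
  note q(2)
  also have "12 * (1 + ln (real N)) * real (sunflower_free_max k q) \<le>
      12 * (1 + ln (real N)) * z ^ q"
    using sunflower[OF q(1)] N by (intro mult_left_mono) auto
  finally have "lcm_free_max k N \<le> 12 * (1 + ln (real N)) * (z / 2) ^ q"
    by (simp add: field_simps)
  also have "\<dots> \<le> 12 * (1 + ln (real N)) * (z / 2) ^ n"
    using z N q(1) by (intro mult_left_mono power_decreasing) auto
  finally show ?thesis by simp
qed simp

lemma power_le_powr_if_le_ln:
  fixes r x :: real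
  assumes "1 \<le> r" "0 < x" "real n \<le> a * ln x"
  shows "r ^ n \<le> x powr (a * ln r)"
proof -
  have "r ^ n = exp (ln r * real n)" using assms(1) by (simp add: exp_of_nat2_mult)
  also have "\<dots> \<le> exp (ln r * (a * ln x))"
    using assms by (intro iffD2[OF exp_le_cancel_iff] mult_left_mono) auto
  finally show ?thesis using assms(2) by (simp add: powr_def mult_ac)
qed

lemma power_le_powr_divide_if_ln_le:
  fixes r x :: real
  assumes "0 < r" "r \<le> 1" "0 < x" "a * ln x \<le> real (Suc n)"
  shows "r ^ n \<le> x powr (a * ln r) / r"
proof -
  have "r ^ Suc n = exp (ln r * real (Suc n))"
    using assms(1) by (simp only: exp_of_nat2_mult exp_ln)
  also have "\<dots> \<le> exp (ln r * (a * ln x))"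
    using assms by (intro iffD2[OF exp_le_cancel_iff] mult_left_mono_neg) auto
  finally have "r * r ^ n \<le> x powr (a * ln r)" using assms(3) by (simp add: powr_def mult_ac)
  then show ?thesis using assms(1) by (simp add: field_simps)
qed

lemma lcm_free_max_le_powr_if_capacity_less_2:
  assumes k: "k \<ge> 2" and cap: "sunflower_capacity k < 2"
  obtains \<beta> where "\<beta> < 1" "\<forall>\<^sub>F N in sequentially. lcm_free_max k N \<le> ln (real N) powr \<beta>"
proof -
  have "max 1 (sunflower_capacity k) < ereal 2" using cap by simp
  from ereal_dense2[OF this] obtain z :: real
    where z: "1 < z" "sunflower_capacity k < ereal z" "z < 2" by auto
  obtain q where q: "\<And>n. n \<ge> q \<Longrightarrow> real (sunflower_free_max k n) < z ^ n"
    using eventually_sunflower_free_max_less[OF z(2)] z(1) by (auto simp: eventually_sequentially)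
  define a b where "a = 1 / 2 * ln (2::real)" and "b = 1 / 2 * ln (z / 2)"
  have "max a (1 + b) < 1" using z ln_less_self[of "2::real"] by (simp add: a_def b_def)
  then obtain \<beta> where \<beta>: "a < \<beta>" "1 + b < \<beta>" "\<beta> < 1" using dense[of "max a (1 + b)" 1] by auto
  define n where "n N = nat \<lfloor>1 / 2 * ln (ln (real N))\<rfloor>" for N :: nat
  have "\<forall>\<^sub>F N in sequentially. 12 * ln (real N) powr a \<le> ln (real N) powr \<beta>"
    using \<beta>(1) by real_asymp
  moreover have "\<forall>\<^sub>F N in sequentially.
      12 * (1 + ln (real N)) * (ln (real N) powr b / (z / 2)) \<le> ln (real N) powr \<beta>"
    using \<beta>(2) z(1) by real_asymp
  moreover have "\<forall>\<^sub>F N in sequentially. real q + 1 \<le> 1 / 2 * ln (ln (real N))" by real_asymp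
  moreover have "\<forall>\<^sub>F N in sequentially. (3::nat) \<le> N" by (rule eventually_ge_at_top)
  ultimately have "\<forall>\<^sub>F N in sequentially. lcm_free_max k N \<le> ln (real N) powr \<beta>"
  proof eventually_elim
    case (elim N)
    have lnN: "0 < ln (real N)" using elim(4) by simp
    have n: "real (n N) \<le> 1 / 2 * ln (ln (real N))" "1 / 2 * ln (ln (real N)) \<le> real (Suc (n N))"
      "q \<le> n N"
      using elim(3) unfolding n_def by linarith+
    have "2 ^ n N \<le> ln (real N) powr a"
      unfolding a_def using lnN n(1) by (intro power_le_powr_if_le_ln) auto
    then have "12 * 2 ^ n N \<le> ln (real N) powr \<beta>" using elim(1) by linarith
    moreover have "(z / 2) ^ n N \<le> ln (real N) powr b / (z / 2)"
      unfolding b_def using z lnN n(2) by (intro power_le_powr_divide_if_ln_le) auto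
    then have "12 * (1 + ln (real N)) * (z / 2) ^ n N \<le> ln (real N) powr \<beta>"
      using lnN by (intro order_trans[OF mult_left_mono elim(2)]) auto
    moreover have "lcm_free_max k N \<le> max (12 * 2 ^ n N) (12 * (1 + ln (real N)) * (z / 2) ^ n N)"
      using k elim(4) z q n(3)
      by (intro lcm_free_max_le_if_sunflower_free_max_le) (auto intro: less_imp_le)
    ultimately show ?case by linarith
  qed
  then show thesis using \<beta>(3) that by blast
qed

section \<open>Lower bounds for LCM-free sets\<close>

lemma sum_powers_le_lcm_free_max:
  fixes \<delta> \<eta> :: real
  assumes k: "k \<ge> 3" and V: "finite V" and F: "\<F> \<subseteq> Pow V" "union_free k \<F>"
    and P: "P \<subseteq> primes_le Y" "\<And>p. p \<in> P \<Longrightarrow> 1 / real p \<le> \<eta>"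
    and pos: "0 \<le> \<delta>" "0 \<le> \<eta>" and Y: "Y \<ge> 1"
    and mass: "real (card V) * (\<delta> + \<eta>) \<le> (\<Sum>p\<in>P. 1 / real p)" and N: "Y ^ card V \<le> N"
  shows "(\<Sum>S\<in>\<F>. \<delta> ^ card S) \<le> lcm_free_max k N"
proof -
  have "finite P" using P(1) finite_primes_le by (rule finite_subset)
  then obtain Q where Q: "\<And>i. i \<in> V \<Longrightarrow> Q i \<subseteq> P" "\<And>i. i \<in> V \<Longrightarrow> \<delta> \<le> (\<Sum>p\<in>Q i. 1 / real p)"
    and disj: "disjoint_family_on Q V"
    using exists_disjoint_subsets_sum_ge[OF V, of P "\<lambda>p. 1 / real p" \<eta> \<delta>] P(2) mass pos by blast
  have blow_up: "X \<subseteq> primes_le Y" "card X \<le> card V" if "X \<in> blow_up Q \<F>" for X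
    using blow_up_subset_card_le[OF V F(1) Q(1) that] P(1) by auto
  then have sets: "blow_up Q \<F> \<subseteq> prime_sets" by (blast intro: subset_primes_le_imp_prime_sets)
  have "(\<Sum>S\<in>\<F>. \<delta> ^ card S) = (\<Sum>S\<in>\<F>. \<Prod>j\<in>S. \<delta>)" by simp
  also have "\<dots> \<le> (\<Sum>S\<in>\<F>. \<Prod>j\<in>S. \<Sum>p\<in>Q j. 1 / real p)"
    using Q(2) F(1) pos(1) by (intro sum_mono prod_mono) auto
  also have "\<dots> = (\<Sum>X\<in>blow_up Q \<F>. \<Prod>p\<in>X. 1 / real p)"
    using V disj F(1) finite_subset[OF Q(1) \<open>finite P\<close>] by (rule sum_prod_blow_up[symmetric])
  also have "\<dots> = (\<Sum>X\<in>blow_up Q \<F>. 1 / real (\<Prod>X))" by (simp add: prod_dividef)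
  also have "\<dots> = (\<Sum>a\<in>\<Prod> ` blow_up Q \<F>. 1 / real a)"
    by (subst sum.reindex[OF inj_on_subset[OF inj_on_prod_primes sets]]) simp
  also have "\<dots> \<le> lcm_free_max k N"
  proof (rule lcm_free_max_ge)
    show "lcm_free k (\<Prod> ` blow_up Q \<F>)"
      using sets union_free_blow_up[OF disj F k] by (rule lcm_free_prod_primes)
    have "\<Prod>X \<in> {1..N}" if X: "X \<in> blow_up Q \<F>" for X
    proof -
      have "\<Prod>X \<le> (\<Prod>p\<in>X. Y)"
        using blow_up[OF X] by (intro prod_mono) (auto simp: primes_le_def)
      also have "\<dots> \<le> Y ^ card V" using blow_up[OF X] Y by (simp add: power_increasing)
      also note N
      finally show ?thesis using prod_primes_pos[of X] sets X by (auto simp: Suc_le_eq)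
    qed
    then show "\<Prod> ` blow_up Q \<F> \<subseteq> {1..N}" by (rule image_subsetI)
  qed
  finally show ?thesis .
qed

text \<open>Each point of \<open>R\<close> copies of \<open>V\<close> becomes a group of primes between \<open>K\<close> and \<open>exp z\<close>; a group has
  reciprocal mass at least \<open>\<delta>\<close> and uses up at most \<open>\<alpha>\<close> of the total mass.\<close>

context
  fixes \<alpha> \<gamma> \<delta> :: real and k m :: nat and V :: "'a set" and \<U>
  assumes k: "k \<ge> 3" and V: "finite V" and U: "uniform_union_free k m V \<U>"
    and rate: "exp (\<gamma> * real (card V)) \<le> real (card \<U>) * \<delta> ^ m"
    and \<delta>: "0 < \<delta>" "\<delta> < \<alpha>"
begin

lemma exp_le_lcm_free_max:
  assumes K: "1 / (\<alpha> - \<delta>) \<le> real K" and z: "0 < z"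
    and mass: "real R * (real (card V) * \<alpha>) \<le> ln z - ln 2 - real K"
    and N: "real R * real (card V) * z \<le> ln (real N)" "N \<ge> 1"
  shows "exp (\<gamma> * real (card V) * real R) \<le> lcm_free_max k N"
proof -
  define Y where "Y = nat \<lfloor>exp z\<rfloor>"
  have "1 \<le> exp z" using z by simp
  then have Y: "1 \<le> Y" "real Y \<le> exp z" "exp z \<le> real Y + 1"
    unfolding Y_def by (simp add: le_nat_iff, linarith+)
  let ?P = "primes_le Y - {..K}" and ?V = "{..<R} \<times> V" and ?\<G> = "family_product {..<R} (\<lambda>_. \<U>)"
  have G: "uniform_union_free k (R * m) ?V ?\<G>"
    using uniform_union_free_family_product[of "{..<R}" k "\<lambda>_. V" "\<lambda>_. m" "\<lambda>_. \<U>"] k V U by simp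
  have "z \<le> ln (real Y + 1)" using Y(3) by (simp add: ln_ge_iff)
  then have "ln z \<le> ln (ln (real Y + 1))" using z by (intro ln_mono) auto
  then have primes: "ln z - ln 2 - real K \<le> (\<Sum>p\<in>?P. 1 / real p)"
    using sum_inverse_large_primes_ge[OF Y(1), of K] by linarith
  have "real (Y ^ card ?V) \<le> exp z ^ card ?V" using Y(2) by (simp add: power_mono)
  also have "\<dots> = exp (real R * real (card V) * z)"
    by (simp add: exp_of_nat_mult[symmetric] card_cartesian_product)
  also have "\<dots> \<le> exp (ln (real N))" using N(1) by simp
  also have "\<dots> = real N" using N(2) by simp
  finally have size: "Y ^ card ?V \<le> N" by (simp only: of_nat_le_iff)
  have small: "1 / real p \<le> \<alpha> - \<delta>" if "p \<in> ?P" for p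
  proof -
    have "1 / (\<alpha> - \<delta>) \<le> real p" "0 < real p" using K that by auto
    then show ?thesis using \<delta>(2) by (simp add: field_simps)
  qed
  have "exp (\<gamma> * real (card V) * real R) = exp (\<gamma> * real (card V)) ^ R"
    by (rule exp_of_nat2_mult)
  also have "\<dots> \<le> (real (card \<U>) * \<delta> ^ m) ^ R" using rate by (intro power_mono) auto
  also have "\<dots> = (\<Sum>S\<in>?\<G>. \<delta> ^ card S)"
    using G
    by (simp add: uniform_union_free_def card_family_product power_mult_distrib
        power_mult[symmetric] mult.commute)
  also have "\<dots> \<le> lcm_free_max k N"
  proof (rule sum_powers_le_lcm_free_max[OF k])
    show "real (card ?V) * (\<delta> + (\<alpha> - \<delta>)) \<le> (\<Sum>p\<in>?P. 1 / real p)"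
      using mass primes by (simp add: card_cartesian_product mult.assoc)
  qed (use V G \<delta> Y(1) size small in \<open>auto simp: uniform_union_free_def\<close>)
  finally show ?thesis .
qed

lemma powr_le_lcm_free_max:
  fixes N :: nat
  defines "L \<equiv> ln (ln (real N))"
  assumes K: "1 / (\<alpha> - \<delta>) \<le> real K" and pos: "V \<noteq> {}" "0 < \<gamma>" "0 < \<theta>" "0 < L" "N \<ge> 3"
    and mass: "\<theta> * L \<le> \<kappa> * L - ln 2 - real K"
    and size: "\<theta> * L / \<alpha> * ln (real N) powr \<kappa> \<le> ln (real N)"
    and exponent: "\<beta> * L \<le> \<gamma> * \<theta> / \<alpha> * L - \<gamma> * real (card V)"
  shows "ln (real N) powr \<beta> \<le> lcm_free_max k N"
proof -
  define v where "v = real (card V)"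
  have v: "0 < v" and \<alpha>: "0 < \<alpha>" using V pos(1) \<delta> by (auto simp: v_def card_gt_0_iff)
  have lnN: "0 < ln (real N)" using pos(5) by simp
  define R where "R = nat \<lfloor>\<theta> * L / (v * \<alpha>)\<rfloor>"
  have "0 \<le> \<theta> * L / (v * \<alpha>)" using pos v \<alpha> by simp
  then have R: "real R \<le> \<theta> * L / (v * \<alpha>)" "\<theta> * L / (v * \<alpha>) - 1 \<le> real R"
    unfolding R_def by linarith+
  have "\<beta> * L \<le> \<gamma> * \<theta> / \<alpha> * L - \<gamma> * v" using exponent by (simp add: v_def)
  also have "\<dots> = \<gamma> * v * (\<theta> * L / (v * \<alpha>) - 1)" using v \<alpha> by (simp add: field_simps)
  also have "\<dots> \<le> \<gamma> * v * real R" using R(2) pos(2) v by (intro mult_left_mono) auto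
  finally have "ln (real N) powr \<beta> \<le> exp (\<gamma> * v * real R)"
    using lnN by (simp add: powr_def L_def)
  also have "\<dots> \<le> lcm_free_max k N"
    unfolding v_def
  proof (rule exp_le_lcm_free_max[OF K])
    have "real R * (v * \<alpha>) \<le> \<theta> * L" using R(1) v \<alpha> by (simp add: field_simps)
    also have "\<dots> \<le> ln (ln (real N) powr \<kappa>) - ln 2 - real K"
      using mass lnN by (simp add: L_def)
    finally show "real R * (real (card V) * \<alpha>) \<le> ln (ln (real N) powr \<kappa>) - ln 2 - real K"
      by (simp add: v_def)
    have "real R * v \<le> \<theta> * L / \<alpha>" using R(1) v \<alpha> by (simp add: field_simps)
    then have "real R * v * ln (real N) powr \<kappa> \<le> \<theta> * L / \<alpha> * ln (real N) powr \<kappa>"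
      by (rule mult_right_mono) simp
    also note size
    finally show "real R * real (card V) * ln (real N) powr \<kappa> \<le> ln (real N)" by (simp add: v_def)
  qed (use lnN pos(5) in auto)
  finally show ?thesis .
qed

lemma eventually_powr_le_lcm_free_max:
  assumes "V \<noteq> {}" and \<beta>: "0 < \<beta>" "\<beta> * \<alpha> < \<gamma>"
  shows "\<forall>\<^sub>F N in sequentially. ln (real N) powr \<beta> \<le> lcm_free_max k N"
proof -
  have \<alpha>: "0 < \<alpha>" using \<delta> by simp
  have \<gamma>: "0 < \<gamma>" using less_trans[OF mult_pos_pos[OF \<beta>(1) \<alpha>] \<beta>(2)] .
  have "\<beta> * \<alpha> / \<gamma> < 1" using \<beta>(2) \<gamma> by simp
  then obtain \<theta> where \<theta>: "\<beta> * \<alpha> / \<gamma> < \<theta>" "\<theta> < 1" using dense by blast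
  obtain \<kappa> where \<kappa>: "\<theta> < \<kappa>" "\<kappa> < 1" using dense[OF \<theta>(2)] by blast
  have \<theta>_pos: "0 < \<theta>"
    using less_trans[OF divide_pos_pos[OF mult_pos_pos[OF \<beta>(1) \<alpha>] \<gamma>] \<theta>(1)] .
  have exponent: "\<beta> < \<gamma> * \<theta> / \<alpha>" using \<theta>(1) \<alpha> \<gamma> by (simp add: field_simps)
  obtain K :: nat where K: "1 / (\<alpha> - \<delta>) \<le> real K" using real_arch_simple by blast
  have "\<forall>\<^sub>F N in sequentially. \<theta> * ln (ln (real N)) \<le> \<kappa> * ln (ln (real N)) - ln 2 - real K"
    using \<kappa>(1) by real_asymp
  moreover have "\<forall>\<^sub>F N in sequentially. \<theta> * ln (ln (real N)) / \<alpha> * ln (real N) powr \<kappa> \<le> ln (real N)"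
    using \<theta>_pos \<alpha> \<kappa>(2) by real_asymp
  moreover have "\<forall>\<^sub>F N in sequentially.
      \<beta> * ln (ln (real N)) \<le> \<gamma> * \<theta> / \<alpha> * ln (ln (real N)) - \<gamma> * real (card V)"
    using exponent by real_asymp
  moreover have "\<forall>\<^sub>F N in sequentially. 0 < ln (ln (real N))" by real_asymp
  moreover have "\<forall>\<^sub>F N in sequentially. (3::nat) \<le> N" by (rule eventually_ge_at_top)
  ultimately show ?thesis
    by eventually_elim (rule powr_le_lcm_free_max[OF K assms(1) \<gamma> \<theta>_pos])
qed

end

lemma lcm_free_max_ge_powr_if_capacity_2:
  assumes k: "k \<ge> 3" and cap: "sunflower_capacity k = 2" and \<beta>: "0 < \<beta>" "\<beta> < 1"
  shows "\<forall>\<^sub>F N in sequentially. ln (real N) powr \<beta> \<le> lcm_free_max k N"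
proof -
  define \<delta> where "\<delta> = (1 - \<beta>) / 2"
  have \<delta>: "0 < \<delta>" "\<delta> \<le> 1" using \<beta> by (auto simp: \<delta>_def)
  have "\<beta> * \<delta> < (1 - \<delta>) * \<delta>"
    using \<beta> \<delta> by (intro mult_strict_right_mono) (auto simp: \<delta>_def field_simps)
  also have "\<dots> = \<delta> - \<delta>\<^sup>2" by (simp add: power2_eq_square algebra_simps)
  also have "\<dots> \<le> ln (1 + \<delta>)" using \<delta> by (intro ln_one_plus_pos_lower_bound) auto
  finally obtain \<gamma> where \<gamma>: "\<beta> * \<delta> < \<gamma>" "\<gamma> < ln (1 + \<delta>)" using dense by blast
  then have "\<delta> < \<gamma> / \<beta>" using \<beta>(1) by (simp add: field_simps)
  then obtain \<alpha> where \<alpha>: "\<delta> < \<alpha>" "\<alpha> < \<gamma> / \<beta>" using dense by blast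
  obtain V :: "nat set" and m \<U> where U: "finite V" "V \<noteq> {}" "uniform_union_free k m V \<U>"
    "exp (\<gamma> * real (card V)) \<le> real (card \<U>) * \<delta> ^ m"
    using exists_dense_uniform_union_free[OF _ cap \<delta> \<gamma>(2)] k by auto
  have "\<beta> * \<alpha> < \<gamma>" using \<alpha>(2) \<beta>(1) by (simp add: field_simps)
  then show ?thesis
    by (rule eventually_powr_le_lcm_free_max[OF k U(1,3,4) \<delta>(1) \<alpha>(1) U(2) \<beta>(1)])
qed

section \<open>The exponent of \<open>log N\<close>\<close>

lemma powr_one_minus_o1_iff:
  fixes f g :: "'a \<Rightarrow> real"
  assumes f: "\<forall>\<^sub>F x in F. 0 < f x" and g: "\<forall>\<^sub>F x in F. 1 < g x"
  shows "(\<exists>\<epsilon>. (\<epsilon> \<longlongrightarrow> 0) F \<and> (\<forall>\<^sub>F x in F. f x = g x powr (1 - \<epsilon> x))) \<longleftrightarrow>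
    ((\<lambda>x. log (g x) (f x)) \<longlongrightarrow> 1) F"
proof
  assume "\<exists>\<epsilon>. (\<epsilon> \<longlongrightarrow> 0) F \<and> (\<forall>\<^sub>F x in F. f x = g x powr (1 - \<epsilon> x))"
  then obtain \<epsilon> where \<epsilon>: "(\<epsilon> \<longlongrightarrow> 0) F" "\<forall>\<^sub>F x in F. f x = g x powr (1 - \<epsilon> x)" by blast
  have "\<forall>\<^sub>F x in F. 1 - \<epsilon> x = log (g x) (f x)" using \<epsilon>(2) g by eventually_elim simp
  moreover have "((\<lambda>x. 1 - \<epsilon> x) \<longlongrightarrow> 1) F" using tendsto_diff[OF tendsto_const \<epsilon>(1), of 1] by simp
  ultimately show "((\<lambda>x. log (g x) (f x)) \<longlongrightarrow> 1) F" by (simp add: tendsto_cong)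
next
  assume lim: "((\<lambda>x. log (g x) (f x)) \<longlongrightarrow> 1) F"
  have "((\<lambda>x. 1 - log (g x) (f x)) \<longlongrightarrow> 0) F" using tendsto_diff[OF tendsto_const lim, of 1] by simp
  moreover have "\<forall>\<^sub>F x in F. f x = g x powr (1 - (1 - log (g x) (f x)))"
    using f g by eventually_elim simp
  ultimately show "\<exists>\<epsilon>. (\<epsilon> \<longlongrightarrow> 0) F \<and> (\<forall>\<^sub>F x in F. f x = g x powr (1 - \<epsilon> x))" by blast
qed

lemma eventually_1_less_ln: "\<forall>\<^sub>F N in sequentially. 1 < ln (real N)"
  by real_asymp

lemma eventually_lcm_free_max_pos:
  assumes "k \<ge> 2"
  shows "\<forall>\<^sub>F N in sequentially. 0 < lcm_free_max k N"
  using eventually_ge_at_top[of 1]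
  by eventually_elim (use lcm_free_max_ge_1[OF assms] in \<open>fastforce intro: less_le_trans\<close>)

lemma log_lcm_free_max_tendsto_1:
  assumes k: "k \<ge> 3" and cap: "sunflower_capacity k = 2"
  shows "(\<lambda>N. log (ln (real N)) (lcm_free_max k N)) \<longlonglongrightarrow> 1"
proof (rule order_tendstoI)
  fix a :: real assume "a < 1"
  then have "max 0 a < 1" by simp
  then obtain \<beta> where \<beta>: "max 0 a < \<beta>" "\<beta> < 1" using dense by blast
  have "\<forall>\<^sub>F N in sequentially. ln (real N) powr \<beta> \<le> lcm_free_max k N"
    using \<beta> by (intro lcm_free_max_ge_powr_if_capacity_2[OF k cap]) auto
  moreover have "\<forall>\<^sub>F N in sequentially. 0 < lcm_free_max k N"
    using k by (intro eventually_lcm_free_max_pos) simp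
  ultimately show "\<forall>\<^sub>F N in sequentially. a < log (ln (real N)) (lcm_free_max k N)"
    using eventually_1_less_ln
  proof eventually_elim
    case (elim N)
    then have "\<beta> \<le> log (ln (real N)) (lcm_free_max k N)" by (simp add: le_log_iff)
    then show ?case using \<beta>(1) by simp
  qed
next
  fix a :: real assume "1 < a"
  then have "\<forall>\<^sub>F N in sequentially. 1 + ln (real N) < ln (real N) powr a" by real_asymp
  moreover have "\<forall>\<^sub>F N in sequentially. 0 < lcm_free_max k N"
    using k by (intro eventually_lcm_free_max_pos) simp
  ultimately show "\<forall>\<^sub>F N in sequentially. log (ln (real N)) (lcm_free_max k N) < a"
    using eventually_1_less_ln eventually_ge_at_top[of 1]
  proof eventually_elim
    case (elim N)
    then have "lcm_free_max k N < ln (real N) powr a" using lcm_free_max_le[of k N] k by simp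
    then show ?case using elim(2,3) by (simp add: log_less_iff)
  qed
qed

lemma sunflower_capacity_eq_2_if_log_tendsto_1:
  assumes k: "k \<ge> 2" and lim: "(\<lambda>N. log (ln (real N)) (lcm_free_max k N)) \<longlonglongrightarrow> 1"
  shows "sunflower_capacity k = 2"
proof (rule ccontr)
  assume "sunflower_capacity k \<noteq> 2"
  moreover have "sunflower_capacity k \<le> 2" using k by (intro sunflower_capacity_le_2) simp
  ultimately have "sunflower_capacity k < 2" by simp
  with k obtain \<beta> where \<beta>: "\<beta> < 1" "\<forall>\<^sub>F N in sequentially. lcm_free_max k N \<le> ln (real N) powr \<beta>"
    by (rule lcm_free_max_le_powr_if_capacity_less_2)
  have "\<forall>\<^sub>F N in sequentially. log (ln (real N)) (lcm_free_max k N) \<le> \<beta>"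
    using \<beta>(2) eventually_lcm_free_max_pos[OF k] eventually_1_less_ln
    by eventually_elim (simp add: log_le_iff)
  with lim have "1 \<le> \<beta>" by (rule tendsto_upperbound) simp
  then show False using \<beta>(1) by simp
qed

theorem theorem1p4:
  fixes k :: nat
  assumes "k \<ge> 3"
  shows "sunflower_capacity k = 2 \<longleftrightarrow>
    (\<exists>\<epsilon> :: nat \<Rightarrow> real. \<epsilon> \<longlonglongrightarrow> 0 \<and>
       (\<forall>\<^sub>F N in sequentially. lcm_free_max k N = ln (real N) powr (1 - \<epsilon> N)))"
proof -
  have k: "k \<ge> 2" using assms by simp
  have "sunflower_capacity k = 2 \<longleftrightarrow> (\<lambda>N. log (ln (real N)) (lcm_free_max k N)) \<longlonglongrightarrow> 1"
    using log_lcm_free_max_tendsto_1[OF assms] sunflower_capacity_eq_2_if_log_tendsto_1[OF k]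
    by blast
  also have "\<dots> \<longleftrightarrow> (\<exists>\<epsilon> :: nat \<Rightarrow> real. \<epsilon> \<longlonglongrightarrow> 0 \<and>
      (\<forall>\<^sub>F N in sequentially. lcm_free_max k N = ln (real N) powr (1 - \<epsilon> N)))"
    using eventually_lcm_free_max_pos[OF k] eventually_1_less_ln
    by (rule powr_one_minus_o1_iff[symmetric])
  finally show ?thesis .
qed

end
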